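(* Suppose $L_z=2^i\ell$ with $\ell$ odd, and consider Haah's cubic code compactified in the $\hat z$ direction with compactification radius $L_z$. Let $O_x,O_y,O_z$ be the orders of the actions of the unit translations $T_x,T_y,T_z$ on the anyon types of the compactified model. Then $$O_x=O_y\le 2^{i+1}(2^k-1),$$ where $k$ is the least common multiple of $2$ and the multiplicative order of $2$ modulo $\ell$. In particular, \begin{align*} O_x&\le 2^{i+1}(2^{\ell-1}-1),\\ O_x&=2^{i+1}\ell &&\text{if } \ell=2^n-1 \text{ for } n \text{ even},\\ O_x&\le 2^{i+1}\ell(\ell+2) &&\text{if } \ell=2^n-1 \text{ for } n \text{ odd}. \end{align*} Moreover, $O_z=L_z$ if $\ell\ne 3$, and $O_z=2^i$ if $\ell=3$.
   Context: **Cubic code.** Qubits live on the cubic lattice $\mathbb Z^3$, two qubits (first and second) per site. For each $v\in\mathbb Z^3$ there are two stabilizer generators, where $e_x,e_y,e_z$ are the unit lattice vectors. - The $X$-generator at $v$ is the product of Pauli $X$ on the first qubit of the sites $v,\ v+e_x+e_y,\ v+e_y+e_z,\ v+e_z+e_x$ and Pauli $X$ on the second qubit of the sites $v,\ v+e_x,\ v+e_y,\ v+e_z$. - The $Z$-generator at $v$ is the product of Pauli $Z$ on the first qubit of the sites $v+e_x+e_y+e_z,\ v+e_x+e_y,\ v+e_y+e_z,\ v+e_z+e_x$ and Pauli $Z$ on the second qubit of the sites $v+e_x+e_y+e_z,\ v+e_x,\ v+e_y,\ v+e_z$. All generators commute. **Compactification.** For a positive integer $L_z$, the model compactified in the $\hat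 z$ direction with radius $L_z$ is the same set of generators on the lattice $\mathbb Z^2\times(\mathbb Z/L_z\mathbb Z)$, i.e. periodic in $z$ with period $L_z$ (Pauli factors that coincide after this identification are multiplied), regarded as a 2D stabilizer model on $\mathbb Z^2$ with $2L_z$ qubits per site. **Anyons and translation orders.** The anyon types (topological superselection sectors) of the compactified model form the abelian group of finite sets of violated stabilizer generators (an $\mathbb F_2$-vector space) modulo those sets that are exactly the violations created by a finitely supported Pauli operator; this group is finite. The unit lattice translations $T_x,T_y$ in the two infinite directions and $T_z$ in the periodic direction act on this group by linear automorphisms $\bar T_x,\bar T_y,\bar T_z$. For $j\in\{x,y,z\}$, $O_j$ is the order of $\bar T_j$, i.e. the smallest positive integer with $\bar T_j^{O_j}=1$. The multiplicative order of $2$ modulo $\ell$ is the smallest positive integer $m$ with $2^m\equiv 1 \pmod{\ell}$ (so it is $1$ when $\ell=1$).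
   Formalization: The bound O_x ≤ 2^{i+1}(2^{ℓ-1}-1) is stated only for ℓ≠1 (at ℓ=1 it would read O_x ≤ 0), and the equality O_x = 2^{i+1}ℓ for ℓ=2^n-1, n even, only for ℓ≠3 (at ℓ=3, O_x divides 2^{i+1}, so the equality fails). *)

theory Defs
  imports "HOL-Algebra.Coset" "HOL-Number_Theory.Number_Theory"
begin

text \<open>The lattice is \<open>\<int>\<^sup>2 \<times> \<int>/L\<close>, with \<open>\<int>/L\<close> represented by the residues
  \<open>0, \<dots>, L - 1\<close>. Displacements are arbitrary vectors in \<open>\<int>\<^sup>3\<close>.\<close>

type_synonym site = "int \<times> int \<times> int"

definition sites :: "nat \<Rightarrow> site set" where
  "sites L = UNIV \<times> UNIV \<times> {0..<int L}"

definition translate :: "nat \<Rightarrow> site \<Rightarrow> site \<Rightarrow> site" where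
  "translate L = (\<lambda>(a, b, c) (x, y, z). (x + a, y + b, (z + c) mod int L))"

datatype qubit = First site | Second site

definition qubits :: "nat \<Rightarrow> qubit set" where
  "qubits L = First ` sites L \<union> Second ` sites L"

text \<open>Pauli operators are taken modulo phases: \<open>(A, B)\<close> stands for the product of the Pauli
  \<open>X\<close> on all qubits in \<open>A\<close> and of the Pauli \<open>Z\<close> on all qubits in \<open>B\<close>, so a qubit in
  \<open>A \<inter> B\<close> carries a Pauli \<open>Y\<close>. Repeated factors cancel since \<open>X\<^sup>2 = Z\<^sup>2 = 1\<close>.\<close>

type_synonym pauli = "qubit set \<times> qubit set"

definition pauli_X :: "qubit \<Rightarrow> pauli" where
  "pauli_X q = ({q}, {})"

definition pauli_Z :: "qubit \<Rightarrow> pauli" where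
  "pauli_Z q = ({}, {q})"

definition pauli_mult :: "pauli \<Rightarrow> pauli \<Rightarrow> pauli" where
  "pauli_mult P Q = (sym_diff (fst P) (fst Q), sym_diff (snd P) (snd Q))"

definition pauli_prod :: "pauli list \<Rightarrow> pauli" where
  "pauli_prod Ps = foldr pauli_mult Ps ({}, {})"

definition pauli_operators :: "nat \<Rightarrow> pauli set" where
  "pauli_operators L = {(A, B). finite A \<and> A \<subseteq> qubits L \<and> finite B \<and> B \<subseteq> qubits L}"

text \<open>Interchanging two Pauli operators costs one sign for each qubit on which an \<open>X\<close> of one
  meets a \<open>Z\<close> of the other.\<close>

definition anticommute :: "pauli \<Rightarrow> pauli \<Rightarrow> bool" where
  "anticommute P Q \<longleftrightarrow> odd (card (fst P \<inter> snd Q) + card (snd P \<inter> fst Q))"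

text \<open>A generator is recorded by its type and position; \<open>generator_op\<close> is its operator.\<close>

datatype generator = XGen site | ZGen site

definition generators :: "nat \<Rightarrow> generator set" where
  "generators L = XGen ` sites L \<union> ZGen ` sites L"

fun generator_op :: "nat \<Rightarrow> generator \<Rightarrow> pauli" where
  "generator_op L (XGen v) = pauli_prod
     ([pauli_X (First (translate L d v)). d \<leftarrow> [(0,0,0), (1,1,0), (0,1,1), (1,0,1)]] @
      [pauli_X (Second (translate L d v)). d \<leftarrow> [(0,0,0), (1,0,0), (0,1,0), (0,0,1)]])"
| "generator_op L (ZGen v) = pauli_prod
     ([pauli_Z (First (translate L d v)). d \<leftarrow> [(1,1,1), (1,1,0), (0,1,1), (1,0,1)]] @
      [pauli_Z (Second (translate L d v)). d \<leftarrow> [(1,1,1), (1,0,0), (0,1,0), (0,0,1)]])"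

definition violated :: "nat \<Rightarrow> pauli \<Rightarrow> generator set" where
  "violated L P = {g \<in> generators L. anticommute P (generator_op L g)}"

definition excitation_group :: "nat \<Rightarrow> generator set monoid" where
  "excitation_group L =
     \<lparr>carrier = {S. finite S \<and> S \<subseteq> generators L}, mult = sym_diff, one = {}\<rparr>"

definition created :: "nat \<Rightarrow> generator set set" where
  "created L = violated L ` pauli_operators L"

definition anyon_group :: "nat \<Rightarrow> generator set set monoid" where
  "anyon_group L = excitation_group L Mod created L"

fun translate_generator :: "nat \<Rightarrow> site \<Rightarrow> generator \<Rightarrow> generator" where
  "translate_generator L d (XGen v) = XGen (translate L d v)"
| "translate_generator L d (ZGen v) = ZGen (translate L d v)"

text \<open>Anyon types are cosets of sets of generators, so the induced action is a twofold image.\<close>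

definition anyon_translation :: "nat \<Rightarrow> site \<Rightarrow> generator set set \<Rightarrow> generator set set" where
  "anyon_translation L d a = (\<lambda>S. translate_generator L d ` S) ` a"

definition translation_order :: "nat \<Rightarrow> site \<Rightarrow> nat" where
  "translation_order L d =
     (LEAST m. 0 < m \<and> (\<forall>a\<in>carrier (anyon_group L). (anyon_translation L d ^^ m) a = a))"

abbreviation order_x :: "nat \<Rightarrow> nat" where
  "order_x L \<equiv> translation_order L (1, 0, 0)"

abbreviation order_y :: "nat \<Rightarrow> nat" where
  "order_y L \<equiv> translation_order L (0, 1, 0)"

abbreviation order_z :: "nat \<Rightarrow> nat" where
  "order_z L \<equiv> translation_order L (0, 0, 1)"

end

theory Submission
  imports Defs "HOL-Library.Poly_Mapping" "HOL-Library.Product_Plus" "HOL-Library.Z2"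
    "HOL-Computational_Algebra.Polynomial"
begin

text \<open>Sets of violated generators of one type, modulo those created by errors, form the ring
  \<open>A = \<F>\<^sub>2[x\<^sup>\<plusminus>, y\<^sup>\<plusminus>, z] / (1 + x + y + z, 1 + x y + y z + z x, z\<^sup>L - 1)\<close>, and translations act on it by
  multiplication with the monomials. With \<open>X = x + 1\<close> and \<open>Z = z + 1\<close> the first two relations become
  \<open>X\<^sup>2 + X Z + Z\<^sup>2 = 0\<close>, and \<open>x y = u\<close> for \<open>u = 1 + z + z\<^sup>2\<close>. Repeated squaring gives
  \<open>x ^ 2 ^ (i + 1 + k) = x ^ 2 ^ (i + 1)\<close>, which bounds the order of \<open>x\<close>.
  Conversely \<open>\<F>\<^sub>2[X, Z] / (X\<^sup>2 + X Z + Z\<^sup>2)\<close> is free over \<open>\<F>\<^sub>2[Z]\<close> with basis \<open>1, X\<close>, and a power \<open>w\<close> of \<open>x\<close> or \<open>z\<close>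
  can be \<open>1\<close> in \<open>A\<close> only if \<open>z\<^sup>L - 1\<close> divides \<open>u ^ 2 ^ i (w - 1)\<close> there, which is excluded by comparing
  degrees, or modulo \<open>Z ^ 2 ^ i\<close>.\<close>

section \<open>Frobenius periods modulo the stabilizer relations\<close>

text \<open>In \<open>A\<close> the elements \<open>x\<close> and \<open>y\<close> are units, but in
  the ring that is free over the polynomials in \<open>Z\<close>, taken modulo
  \<open>z ^ L - 1\<close>, they need not be, and degrees can only be compared there. As
  \<open>x y = u\<close>, passing to \<open>A\<close> kills exactly what some power of
  \<open>u\<close> annihilates. Modulo \<open>z ^ L - 1\<close> the powers \<open>u ^ 2 ^ j\<close>
  are periodic from \<open>j = i\<close> on, so \<open>u ^ 2 ^ i\<close> stands in for every power.
  Its degree in \<open>Z\<close> is \<open>2 * 2 ^ i\<close>, against the degree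
  \<open>2 ^ i * l\<close> of \<open>z ^ L - 1\<close>; this leaves room for comparing degrees
  unless \<open>l\<close> is small. The case \<open>l = 3\<close> is a genuine exception: with
  \<open>w = z ^ 2 ^ i\<close> one has \<open>u ^ 2 ^ i * (w - 1) = w ^ 3 - 1 = 0\<close>, and
  cancelling the unit \<open>u\<close> gives \<open>w = 1\<close>.\<close>

lemma frobenius_char_2:
  fixes a b :: "'a::comm_ring_1"
  assumes "(2::'a) = 0"
  shows "(a + b) ^ 2 ^ n = a ^ 2 ^ n + b ^ 2 ^ n"
proof (induction n)
  case (Suc n)
  have "(a + b) ^ 2 ^ Suc n = ((a + b) ^ 2 ^ n) ^ 2"
    by (simp only: power_mult [symmetric] power_Suc2)
  also have "\<dots> = (a ^ 2 ^ n) ^ 2 + (b ^ 2 ^ n) ^ 2"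
    by (simp add: Suc power2_sum assms)
  finally show ?case
    by (simp only: power_mult [symmetric] power_Suc2)
qed simp

text \<open>Nothing is assumed invertible, because the same computations serve two kinds of rings:
  Laurent polynomials with the ideals \<open>relations G\<close>, where monomials are units, and
  \<open>quad\<close> with the multiples of a fixed element, where \<open>qx\<close> and
  \<open>qy\<close> are not units.\<close>

locale cubic_ideal =
  fixes I :: "'a::comm_ring_1 set" and x y z :: 'a and i l :: nat
  assumes zero_in: "0 \<in> I"
    and add_in: "a \<in> I \<Longrightarrow> b \<in> I \<Longrightarrow> a + b \<in> I"
    and mult_in: "a \<in> I \<Longrightarrow> r * a \<in> I"
    and two: "(2::'a) = 0"
    and linear_in: "1 + x + y + z \<in> I"
    and quadratic_in: "1 + x * y + y * z + z * x \<in> I"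
    and periodic: "z ^ (2 ^ i * l) - 1 \<in> I"
    and odd_l: "odd l"
begin

definition eqv :: "'a \<Rightarrow> 'a \<Rightarrow> bool" (infix "\<sim>" 50)
  where "a \<sim> b \<longleftrightarrow> a - b \<in> I"

lemma double: "a + a = (0::'a)"
  by (metis two mult_2 mult_zero_left)

lemma minus_eq: "- a = (a::'a)"
  by (metis double minus_unique)

lemma diff_eq: "a - b = a + (b::'a)"
  by (metis minus_eq diff_conv_add_uminus)

lemma eqv_refl [simp]: "a \<sim> a"
  by (simp add: eqv_def zero_in)

lemma eqv_sym: "a \<sim> b \<Longrightarrow> b \<sim> a"
  by (simp add: eqv_def diff_eq add.commute)

lemma eqv_trans [trans]: "a \<sim> b \<Longrightarrow> b \<sim> c \<Longrightarrow> a \<sim> c"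
  unfolding eqv_def using add_in [of "a - b" "b - c"] by simp

lemma eqv_add: "a \<sim> b \<Longrightarrow> c \<sim> d \<Longrightarrow> a + c \<sim> b + d"
  unfolding eqv_def using add_in [of "a - b" "c - d"] by (simp add: algebra_simps)

lemma eqv_mult: "a \<sim> b \<Longrightarrow> c \<sim> d \<Longrightarrow> a * c \<sim> b * d"
proof -
  assume "a \<sim> b" "c \<sim> d"
  then have "c * (a - b) + b * (c - d) \<in> I"
    unfolding eqv_def by (intro add_in mult_in)
  then show ?thesis by (simp add: eqv_def algebra_simps)
qed

lemma eqv_power: "a \<sim> b \<Longrightarrow> a ^ n \<sim> b ^ n"
  by (induction n) (auto intro: eqv_mult)

lemma eqv_0_iff: "a \<sim> 0 \<longleftrightarrow> a \<in> I"
  by (simp add: eqv_def)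

definition u :: 'a where "u = 1 + z + z\<^sup>2"

lemma xy_eqv_u: "x * y \<sim> u"
proof -
  \<comment> \<open>Adding \<open>z\<close> times the linear relation doubles \<open>y * z\<close>
    and \<open>z * x\<close>, leaving \<open>x * y\<close> and a polynomial in
    \<open>z\<close>.\<close>
  have "(1 + x * y + y * z + z * x) + z * (1 + x + y + z) \<in> I"
    by (intro add_in mult_in linear_in quadratic_in)
  also have "(1 + x * y + y * z + z * x) + z * (1 + x + y + z)
      = x * y + u + 2 * (y * z + z * x)"
    by (simp add: u_def algebra_simps power2_eq_square)
  finally show ?thesis
    by (simp add: eqv_def two diff_eq)
qed

lemma z_power_mod: "z ^ (a + 2 ^ i * l * b) \<sim> z ^ a"
proof -
  have "z ^ (2 ^ i * l) \<sim> 1" by (simp add: eqv_def periodic)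
  then have "z ^ a * (z ^ (2 ^ i * l)) ^ b \<sim> z ^ a * 1 ^ b"
    by (intro eqv_mult eqv_power eqv_refl)
  then show ?thesis by (simp add: power_add power_mult)
qed

lemma z_power_cong:
  assumes "[a = b] (mod 2 ^ i * l)"
  shows "z ^ a \<sim> z ^ b"
proof -
  have "z ^ a \<sim> z ^ (a mod (2 ^ i * l))" for a
    using z_power_mod [of "a mod (2 ^ i * l)" "a div (2 ^ i * l)"] by simp
  then show ?thesis
    using assms eqv_sym eqv_trans unfolding cong_def by metis
qed

text \<open>Exponents of \<open>z\<close> count modulo \<open>2 ^ i * l\<close>, where 2 is in
  general no unit; the factor \<open>2 ^ i\<close> reduces the congruence to one modulo the odd
  number \<open>l\<close>.\<close>

lemma z_frobenius_period:
  assumes "[2 ^ j = 1] (mod l)"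
  shows "z ^ 2 ^ (i + j) \<sim> z ^ 2 ^ i"
proof -
  have "[2 ^ i * 2 ^ j = 2 ^ i * 1] (mod 2 ^ i * l)"
    using assms by (simp add: cong_def mult_mod_right [symmetric])
  then show ?thesis by (intro z_power_cong) (simp add: power_add)
qed

lemma u_frobenius_period:
  assumes "[2 ^ j = 1] (mod l)"
  shows "u ^ 2 ^ (i + j) \<sim> u ^ 2 ^ i"
proof -
  \<comment> \<open>As squaring is additive, \<open>u ^ 2 ^ n\<close> is a polynomial in
    \<open>z ^ 2 ^ n\<close> and inherits its period.\<close>
  have *: "u ^ 2 ^ n = 1 + z ^ 2 ^ n + (z ^ 2 ^ n)\<^sup>2" for n
    by (simp add: u_def frobenius_char_2 [OF two] power_mult [symmetric] mult.commute)
  show ?thesis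
    unfolding * by (intro eqv_add eqv_power z_frobenius_period assms eqv_refl)
qed

text \<open>Periodicity makes \<open>u ^ 2 ^ i\<close> equivalent to powers of \<open>u\<close> with
  arbitrarily large exponents, and those are multiples of \<open>u ^ K\<close>.\<close>

lemma u_torsion:
  assumes "u ^ K * a \<in> I"
  shows "u ^ 2 ^ i * a \<in> I"
proof -
  have "[2 ^ (ord l 2 * K) = 1] (mod l)"
    by (metis cong_pow ord_works power_mult power_one)
  then have "u ^ 2 ^ (i + ord l 2 * K) * a \<sim> u ^ 2 ^ i * a"
    by (intro eqv_mult u_frobenius_period eqv_refl)
  moreover have "K \<le> 2 ^ (i + ord l 2 * K)"
  proof -
    have "coprime l 2" using odd_l by simp
    then have "ord l 2 > 0" by simp
    then have "K \<le> i + ord l 2 * K"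
      by (metis le_add2 mult_le_mono1 nat_mult_1 One_nat_def Suc_leI le_trans)
    also have "\<dots> < 2 ^ (i + ord l 2 * K)" by (rule less_exp)
    finally show ?thesis by simp
  qed
  then obtain c where "2 ^ (i + ord l 2 * K) = K + c" using le_Suc_ex by blast
  then have "u ^ 2 ^ (i + ord l 2 * K) * a = u ^ c * (u ^ K * a)"
    by (simp add: power_add algebra_simps)
  then have "u ^ 2 ^ (i + ord l 2 * K) * a \<sim> 0"
    using assms by (simp add: eqv_0_iff mult_in)
  ultimately show ?thesis
    using eqv_0_iff eqv_sym eqv_trans by blast
qed

lemma shifted_quadric: "(x + 1)\<^sup>2 \<sim> (x + 1) * (z + 1) + (z + 1)\<^sup>2"
proof -
  \<comment> \<open>The quadratic relation is \<open>1 + y * (x + z) + z * x\<close>, so adding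
    \<open>x + z\<close> times the linear one substitutes \<open>1 + x + z\<close> for
    \<open>y\<close>.\<close>
  have "(1 + x * y + y * z + z * x) + (x + z) * (1 + x + y + z) \<in> I"
    by (intro add_in mult_in linear_in quadratic_in)
  \<comment> \<open>The even terms on both sides make this an identity in every commutative
    ring.\<close>
  also have "(1 + x * y + y * z + z * x) + (x + z) * (1 + x + y + z)
      + 2 * (1 + x + z)
      = (x + 1)\<^sup>2 + ((x + 1) * (z + 1) + (z + 1)\<^sup>2) + 2 * (z * x + x * y + y * z)"
    by (simp add: algebra_simps power2_eq_square)
  then have "(1 + x * y + y * z + z * x) + (x + z) * (1 + x + y + z)
      = (x + 1)\<^sup>2 + ((x + 1) * (z + 1) + (z + 1)\<^sup>2)"
    by (simp add: two)
  finally show ?thesis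
    by (simp add: eqv_def diff_eq)
qed

text \<open>Over \<open>\<F>\<^sub>4\<close> the quadric splits into the lines \<open>x + 1 = \<omega> (z + 1)\<close>, on which the fourth
  power map multiplies \<open>x + 1\<close> by \<open>(z + 1)\<^sup>3\<close>.\<close>

lemma shifted_fourth_power: "(x + 1) ^ 4 \<sim> (x + 1) * (z + 1) ^ 3"
proof -
  define X Z where "X = x + 1" and "Z = z + 1"
  have "X\<^sup>2 * X\<^sup>2 \<sim> (X * Z + Z\<^sup>2) * (X * Z + Z\<^sup>2)"
    unfolding X_def Z_def by (intro eqv_mult shifted_quadric)
  also have "(X * Z + Z\<^sup>2) * (X * Z + Z\<^sup>2) = Z\<^sup>2 * X\<^sup>2 + Z ^ 4 + 2 * (X * Z ^ 3)"
    by (simp add: algebra_simps power2_eq_square power3_eq_cube power4_eq_xxxx)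
  also have "\<dots> = Z\<^sup>2 * X\<^sup>2 + Z ^ 4" by (simp add: two)
  also have "\<dots> \<sim> Z\<^sup>2 * (X * Z + Z\<^sup>2) + Z ^ 4"
    unfolding X_def Z_def by (intro eqv_add eqv_mult shifted_quadric eqv_refl)
  also have "Z\<^sup>2 * (X * Z + Z\<^sup>2) + Z ^ 4 = X * Z ^ 3 + 2 * Z ^ 4"
    by (simp add: algebra_simps power2_eq_square power3_eq_cube power4_eq_xxxx)
  also have "\<dots> = X * Z ^ 3" by (simp add: two)
  also have "X\<^sup>2 * X\<^sup>2 = X ^ 4" by (simp flip: power_add)
  finally show ?thesis by (simp add: X_def Z_def)
qed

text \<open>Formally \<open>(x + 1) / (z + 1)\<close> is a primitive cube root of unity, hence fixed
  by fourth powers. The statement is cross-multiplied because \<open>z + 1\<close> need not be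
  invertible.\<close>

lemma shifted_frobenius:
  "(x + 1) ^ 2 ^ (n + 2 * j) * (z + 1) ^ 2 ^ n \<sim> (x + 1) ^ 2 ^ n * (z + 1) ^ 2 ^ (n + 2 * j)"
proof (induction j)
  case (Suc j)
  define e :: nat where "e = 2 ^ (n + 2 * j)"
  have e: "2 ^ (n + 2 * Suc j) = 4 * e" "4 * e = 3 * e + e" by (simp_all add: e_def)
  have "(x + 1) ^ (4 * e) * (z + 1) ^ 2 ^ n \<sim> ((x + 1) * (z + 1) ^ 3) ^ e * (z + 1) ^ 2 ^ n"
    unfolding power_mult by (intro eqv_mult eqv_power shifted_fourth_power eqv_refl)
  also have "((z + 1) ^ 3) ^ e = (z + 1) ^ (3 * e)"
    by (simp flip: power_mult)
  then have "((x + 1) * (z + 1) ^ 3) ^ e * (z + 1) ^ 2 ^ n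
      = (z + 1) ^ (3 * e) * ((x + 1) ^ e * (z + 1) ^ 2 ^ n)"
    by (simp only: power_mult_distrib mult_ac)
  also have "\<dots> \<sim> (z + 1) ^ (3 * e) * ((x + 1) ^ 2 ^ n * (z + 1) ^ e)"
    unfolding e_def by (rule eqv_mult [OF eqv_refl Suc])
  also have "\<dots> = (x + 1) ^ 2 ^ n * (z + 1) ^ (4 * e)"
    unfolding e(2) power_add by (simp add: mult_ac)
  finally show ?case by (simp only: e(1))
qed simp

lemma shifted_quadric_frobenius:
  "(x + 1) ^ 2 ^ (n + 1) \<sim> (x + 1) ^ 2 ^ n * (z + 1) ^ 2 ^ n + (z + 1) ^ 2 ^ (n + 1)"
proof -
  have "((x + 1)\<^sup>2) ^ 2 ^ n \<sim> ((x + 1) * (z + 1) + (z + 1)\<^sup>2) ^ 2 ^ n"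
    by (intro eqv_power shifted_quadric)
  then show ?thesis
    by (simp add: frobenius_char_2 [OF two] power_mult_distrib flip: power_mult)
qed

text \<open>Squaring exchanges \<omega> with its conjugate, so only an even number of squarings
  preserves the two lines; hence \<open>k\<close> is even. Moreover \<open>shifted_frobenius\<close>
  needs a factor that is a power of \<open>z + 1\<close>. One additional squaring produces it
  through the quadric, whence \<open>i + 1\<close> in place of \<open>i\<close>.\<close>

lemma x_frobenius_period:
  assumes "even k" "[2 ^ k = 1] (mod l)"
  shows "x ^ 2 ^ (i + 1 + k) \<sim> x ^ 2 ^ (i + 1)"
proof -
  obtain j where k: "k = 2 * j" using assms(1) by blast
  define X Z where "X = x + 1" and "Z = z + 1"
  have Zk: "Z ^ 2 ^ (i + k) \<sim> Z ^ 2 ^ i"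
    unfolding Z_def frobenius_char_2 [OF two]
    by (intro eqv_add z_frobenius_period assms) simp
  then have "(Z ^ 2 ^ (i + k))\<^sup>2 \<sim> (Z ^ 2 ^ i)\<^sup>2"
    by (rule eqv_power)
  then have Zk': "Z ^ 2 ^ (i + k + 1) \<sim> Z ^ 2 ^ (i + 1)"
    by (simp add: mult.commute flip: power_mult)
  have "X ^ 2 ^ (i + k + 1) \<sim> X ^ 2 ^ (i + k) * Z ^ 2 ^ (i + k) + Z ^ 2 ^ (i + k + 1)"
    unfolding X_def Z_def by (rule shifted_quadric_frobenius)
  also have "\<dots> \<sim> X ^ 2 ^ (i + k) * Z ^ 2 ^ i + Z ^ 2 ^ (i + 1)"
    by (intro eqv_add eqv_mult Zk Zk' eqv_refl)
  also have "\<dots> \<sim> X ^ 2 ^ i * Z ^ 2 ^ (i + k) + Z ^ 2 ^ (i + 1)"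
    unfolding X_def Z_def k by (intro eqv_add shifted_frobenius eqv_refl)
  also have "\<dots> \<sim> X ^ 2 ^ i * Z ^ 2 ^ i + Z ^ 2 ^ (i + 1)"
    by (intro eqv_add eqv_mult Zk eqv_refl)
  also have "\<dots> \<sim> X ^ 2 ^ (i + 1)"
    unfolding X_def Z_def by (rule eqv_sym [OF shifted_quadric_frobenius])
  finally have "X ^ 2 ^ (i + k + 1) + 1 \<sim> X ^ 2 ^ (i + 1) + 1"
    by (intro eqv_add eqv_refl)
  then show ?thesis
    by (simp add: X_def frobenius_char_2 [OF two] add.assoc double add.commute [of k]
        del: power_Suc)
qed

text \<open>The factor \<open>(x * y) ^ 2 ^ i\<close> is equivalent to
  \<open>1 + w + w\<^sup>2\<close>, whose terms are permuted by \<open>w\<close> because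
  \<open>w ^ 3\<close> is 1. It can be cancelled where monomials are units.\<close>

lemma z_power_if_l_eq_3:
  assumes "l = 3"
  shows "(x * y) ^ 2 ^ i * z ^ 2 ^ i \<sim> (x * y) ^ 2 ^ i"
proof -
  define w where "w = z ^ 2 ^ i"
  have w3: "w ^ 3 \<sim> 1"
    using periodic by (simp add: w_def eqv_def assms flip: power_mult)
  have "u ^ 2 ^ i = 1 + w + w\<^sup>2"
    by (simp add: u_def w_def frobenius_char_2 [OF two] power_mult [symmetric] mult.commute)
  then have "u ^ 2 ^ i * w = w ^ 3 + (w + w\<^sup>2)"
    by (simp add: algebra_simps power2_eq_square power3_eq_cube)
  also have "\<dots> \<sim> 1 + (w + w\<^sup>2)" by (intro eqv_add w3 eqv_refl)
  also have "\<dots> = u ^ 2 ^ i" using \<open>u ^ 2 ^ i = _\<close> by (simp add: add.assoc)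
  finally have "u ^ 2 ^ i * w \<sim> u ^ 2 ^ i" .
  moreover have "(x * y) ^ 2 ^ i \<sim> u ^ 2 ^ i" by (intro eqv_power xy_eqv_u)
  ultimately show ?thesis
    unfolding w_def [symmetric] by (meson eqv_mult eqv_refl eqv_sym eqv_trans)
qed

lemma cubic_ideal_swap: "cubic_ideal I y x z i l"
proof
  show "1 + y + x + z \<in> I"
    using linear_in by (simp add: ac_simps)
  show "1 + y * x + x * z + z * y \<in> I"
    using quadratic_in by (simp add: ac_simps)
qed (fact zero_in add_in mult_in two periodic odd_l)+

text \<open>In the quotient by \<open>I\<close> the elements \<open>x\<close> and \<open>y\<close> need not be units, but \<open>x\<^sup>m y\<^sup>m\<close> is an idempotent
  on which they act invertibly with period \<open>m\<close>. This extends monomials to negative exponents.\<close>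

context
  fixes k m :: nat
  assumes k: "even k" "0 < k" "[2 ^ k = 1] (mod l)"
    and m: "m = 2 ^ (i + 1) * (2 ^ k - 1)"
begin

lemma m_ge: "2 ^ (i + 1) \<le> m"
proof -
  have "(2::nat) ^ 1 \<le> 2 ^ k" using k(2) by (intro power_increasing) auto
  then have "1 \<le> (2::nat) ^ k - 1" by simp
  then show ?thesis unfolding m by simp
qed

lemma m_pos: "0 < m"
proof -
  have "(0::nat) < 2 ^ (i + 1)" by simp
  then show ?thesis using m_ge by (rule less_le_trans)
qed

lemma period_sum: "2 ^ (i + 1) + m = 2 ^ (i + 1 + k)"
proof -
  have "2 ^ (i + 1) * 1 + 2 ^ (i + 1) * (2 ^ k - 1) = (2::nat) ^ (i + 1) * (1 + (2 ^ k - 1))"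
    by (rule distrib_left [symmetric])
  also have "1 + (2 ^ k - 1) = (2::nat) ^ k" by simp
  finally show ?thesis by (simp add: m power_add)
qed

lemma x_period: "x ^ (2 * m) \<sim> x ^ m"
proof -
  \<comment> \<open>The period \<open>m\<close> holds from the exponent \<open>2 ^ (i + 1)\<close>
    on; the extra factor raises that exponent to \<open>m\<close>.\<close>
  have "x ^ (m - 2 ^ (i + 1)) * x ^ (2 ^ (i + 1) + m) \<sim> x ^ (m - 2 ^ (i + 1)) * x ^ 2 ^ (i + 1)"
    unfolding period_sum by (intro eqv_mult eqv_refl x_frobenius_period k)
  then show ?thesis
    using m_ge by (simp flip: power_add)
qed

text \<open>The offset \<open>m\<close> moves the exponents of \<open>x\<close> and \<open>y\<close>
  into the range where powers have period \<open>m\<close>. For \<open>z\<close> no offset is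
  required, since \<open>z ^ (2 ^ i * l)\<close> is equivalent to 1.\<close>

definition monomial :: "int \<times> int \<times> int \<Rightarrow> 'a" where
  "monomial = (\<lambda>(a, b, c). x ^ (m + nat (a mod int m)) * y ^ (m + nat (b mod int m))
     * z ^ nat (c mod int (2 ^ i * l)))"

lemma nat_mod_Suc:
  assumes "0 < n"
  shows "nat ((a + 1) mod int n) = (if nat (a mod int n) + 1 = n then 0 else nat (a mod int n) + 1)"
proof -
  have bounds: "0 \<le> a mod int n" "a mod int n < int n" using assms by simp_all
  have "(a + 1) mod int n = (a mod int n + 1) mod int n" by (simp add: mod_add_left_eq)
  also have "\<dots> = (if a mod int n + 1 = int n then 0 else a mod int n + 1)"
    using bounds by (auto simp: mod_pos_pos_trivial)
  finally show ?thesis using bounds by (auto simp: nat_add_distrib)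
qed

lemma x_power_step: "x ^ (m + nat ((a + 1) mod int m)) \<sim> x * x ^ (m + nat (a mod int m))"
proof (cases "nat (a mod int m) + 1 = m")
  \<comment> \<open>The residue wraps around to 0 here, so the exponent drops from
    \<open>2 * m\<close> to \<open>m\<close>.\<close>
  case True
  then have "Suc (m + nat (a mod int m)) = 2 * m" by simp
  then have "x * x ^ (m + nat (a mod int m)) = x ^ (2 * m)"
    by (metis power_Suc)
  with True show ?thesis
    using eqv_sym [OF x_period] nat_mod_Suc [OF m_pos, of a] by simp
qed (use nat_mod_Suc [OF m_pos, of a] in simp)

lemma z_power_step:
  "z ^ nat ((c + 1) mod int (2 ^ i * l)) \<sim> z * z ^ nat (c mod int (2 ^ i * l))"
proof -
  have L: "0 < 2 ^ i * l" using odd_l odd_pos by simp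
  have "[nat ((c + 1) mod int (2 ^ i * l)) = nat (c mod int (2 ^ i * l)) + 1] (mod 2 ^ i * l)"
    using nat_mod_Suc [OF L, of c] by (simp add: cong_def)
  from z_power_cong [OF this] show ?thesis by simp
qed

lemma monomial_add_x: "monomial (a + 1, b, c) \<sim> x * monomial (a, b, c)"
  unfolding monomial_def split mult.assoc [symmetric]
  by (intro eqv_mult x_power_step eqv_refl)

lemma monomial_add_z: "monomial (a, b, c + 1) \<sim> z * monomial (a, b, c)"
  unfolding monomial_def split
  by (subst mult.left_commute) (intro eqv_mult z_power_step eqv_refl)

lemma monomial_mod: "monomial (a, b, c mod int (2 ^ i * l)) = monomial (a, b, c)"
  by (simp add: monomial_def)

lemma monomial_0: "monomial (0, 0, 0) = (x * y) ^ m"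
  by (simp add: monomial_def power_mult_distrib)

end

lemma monomial_add_y:
  assumes "even k" "0 < k" "[2 ^ k = 1] (mod l)" "m = 2 ^ (i + 1) * (2 ^ k - 1)"
  shows "monomial m (a, b + 1, c) \<sim> y * monomial m (a, b, c)"
proof -
  interpret swap: cubic_ideal I y x z i l by (rule cubic_ideal_swap)
  have *: "monomial m (a, b, c) = swap.monomial m (b, a, c)" for a b c
    unfolding monomial_def [OF assms] swap.monomial_def [OF assms] by (simp add: mult.commute)
  show ?thesis
    unfolding * by (rule swap.monomial_add_x [OF assms])
qed

end

section \<open>The coordinate ring of the shifted quadric\<close>

definition Z :: "bit poly" where "Z = [:0, 1:]"

lemma coeff_Z_mult: "coeff (Z * p) n = (if n = 0 then 0 else coeff p (n - 1))"
  by (simp add: Z_def coeff_pCons split: nat.split)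

lemma degree_Z_mult_le: "degree p \<le> n \<Longrightarrow> degree (Z * p) \<le> Suc n"
  unfolding Z_def using degree_pCons_le [of 0 p] by simp

lemma Z_power: "Z ^ n = monom 1 n"
  by (simp add: Z_def monom_altdef)

lemma degree_one_plus_Z_power: "degree ((1 + Z) ^ n) = n"
  by (simp add: Z_def one_pCons degree_power_eq)

text \<open>The ring \<open>\<F>\<^sub>2[X, Z] / (X\<^sup>2 + X Z + Z\<^sup>2)\<close>, with \<open>Quad a b\<close> standing for \<open>a + b X\<close>.\<close>

datatype quad = Quad (re: "bit poly") (im: "bit poly")

instantiation quad :: comm_ring_1
begin

definition "0 = Quad 0 0"
definition "1 = Quad 1 0"
definition "p + q = Quad (re p + re q) (im p + im q)"
definition "p - q = Quad (re p - re q) (im p - im q)"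
definition "- p = Quad (- re p) (- im p)"
definition "p * q = Quad (re p * re q + Z\<^sup>2 * (im p * im q))
  (re p * im q + im p * re q + Z * (im p * im q))"

instance
proof
  fix p q r :: quad
  show "p * q * r = p * (q * r)"
    unfolding times_quad_def by (simp add: algebra_simps power2_eq_square)
  show "p * q = q * p"
    unfolding times_quad_def by (simp add: algebra_simps)
  show "(p + q) * r = p * r + q * r"
    unfolding times_quad_def plus_quad_def by (simp add: algebra_simps)
qed (simp_all add: zero_quad_def one_quad_def plus_quad_def minus_quad_def uminus_quad_def
      times_quad_def)

end

lemma quad_simps [simp]:
  "re 0 = 0" "im 0 = 0" "re 1 = 1" "im 1 = 0"
  "re (p + q) = re p + re q" "im (p + q) = im p + im q"
  "re (p - q) = re p - re q" "im (p - q) = im p - im q"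
  "re (p * q) = re p * re q + Z\<^sup>2 * (im p * im q)"
  "im (p * q) = re p * im q + im p * re q + Z * (im p * im q)"
  by (simp_all add: zero_quad_def one_quad_def plus_quad_def minus_quad_def times_quad_def)

lemma two_bit_poly: "(2::bit poly) = 0"
  by (simp add: numeral_poly)

lemma two_quad: "(2::quad) = 0"
  unfolding one_add_one [symmetric]
proof (rule quad.expand, intro conjI)
  have "re (1 + 1) = re 1 + re 1" by (rule quad_simps)
  also have "\<dots> = 2" by simp
  finally show "re (1 + 1) = re 0" by (simp only: two_bit_poly quad_simps)
  have "im (1 + 1) = im 1 + im 1" by (rule quad_simps)
  then show "im (1 + 1) = im 0" by simp
qed

abbreviation const :: "bit poly \<Rightarrow> quad" where "const a \<equiv> Quad a 0"

lemma const_mult: "const a * p = Quad (a * re p) (a * im p)"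
  by (rule quad.expand) simp

lemma const_power: "const a ^ n = const (a ^ n)"
  by (induction n) (simp_all add: one_quad_def const_mult)

lemma const_add: "const a + const b = const (a + b)"
  by (simp add: plus_quad_def)

lemma const_diff: "const a - const b = const (a - b)"
  by (simp add: minus_quad_def)

lemma const_dvd_iff: "const a dvd p \<longleftrightarrow> a dvd re p \<and> a dvd im p"
proof
  assume "a dvd re p \<and> a dvd im p"
  then obtain r s where "re p = a * r" "im p = a * s" by (auto elim!: dvdE)
  then have "p = const a * Quad r s" by (simp add: const_mult quad.expand)
  then show "const a dvd p" by simp
qed (auto simp: const_mult elim!: dvdE)

definition qx :: quad where "qx = Quad 1 1"
text \<open>The linear relation forces \<open>y = 1 + x + z\<close>, which is
  \<open>1 + X + Z\<close>.\<close>

definition qy :: quad where "qy = Quad (1 + Z) 1"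
definition qz :: quad where "qz = const (1 + Z)"

lemma qz_power: "qz ^ n = const ((1 + Z) ^ n)"
  by (simp add: qz_def const_power)

lemma bit_poly_double: "p + p = (0::bit poly)"
  by (metis mult_2 mult_zero_left two_bit_poly)

lemma bit_poly_double': "p + (p + q) = (q::bit poly)"
  by (simp add: bit_poly_double flip: add.assoc)

lemma quad_relations:
  "1 + qx + qy + qz = 0" "1 + qx * qy + qy * qz + qz * qx = 0"
  by (rule quad.expand; simp add: qx_def qy_def qz_def power2_eq_square algebra_simps
      bit_poly_double bit_poly_double')+

text \<open>The form of degree \<open>m\<close> of \<open>(1 + X)\<^sup>m\<close> is \<open>X\<^sup>m\<close>, which is nonzero.\<close>

lemma qx_power_leading:
  "degree (re (qx ^ m)) \<le> m \<and> degree (Z * im (qx ^ m)) \<le> m \<and>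
    \<not> (coeff (re (qx ^ m)) m = 0 \<and> coeff (Z * im (qx ^ m)) m = 0)"
proof (induction m)
  case (Suc m)
  \<comment> \<open>\<open>X\<close> has degree 1, so the weight \<open>Z\<close> puts the
    coefficient of \<open>X\<close> on the same footing as the constant one.\<close>
  define a b where "a = re (qx ^ m)" and "b = Z * im (qx ^ m)"
  have ab: "degree a \<le> m" "degree b \<le> m" "\<not> (coeff a m = 0 \<and> coeff b m = 0)"
    using Suc unfolding a_def b_def by blast+
  have re: "re (qx ^ Suc m) = a + Z * b"
    by (simp add: a_def b_def qx_def power2_eq_square)
  have im: "Z * im (qx ^ Suc m) = b + Z * a + Z * b"
    by (simp add: a_def b_def qx_def algebra_simps)
  have "coeff a (Suc m) = 0" "coeff b (Suc m) = 0"
    using ab by (simp_all add: coeff_eq_0)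
  then have "coeff (a + Z * b) (Suc m) = coeff b m"
    "coeff (b + Z * a + Z * b) (Suc m) = coeff a m + coeff b m"
    by (simp_all add: coeff_Z_mult)
  moreover have "degree (a + Z * b) \<le> Suc m" "degree (b + Z * a + Z * b) \<le> Suc m"
    by (intro degree_add_le degree_Z_mult_le le_SucI ab)+
  \<comment> \<open>On leading coefficients, multiplication by \<open>X\<close> maps
    \<open>(a, b)\<close> to \<open>(b, a + b)\<close>, which is invertible.\<close>
  moreover have "\<not> (coeff b m = 0 \<and> coeff a m + coeff b m = 0)"
    using ab(3) by (cases "coeff b m = 0") (simp_all only: add_0_right simp_thms)
  ultimately show ?case
    unfolding re im by (simp only: simp_thms)
qed simp

lemma qx_power_neq_1:
  assumes "m > 0"
  shows "qx ^ m \<noteq> 1"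
  using qx_power_leading [of m] assms by (auto simp: coeff_eq_0)

text \<open>Squaring \<open>a + b X\<close> doubles the cross term and turns
  \<open>b\<^sup>2 X\<^sup>2\<close> into \<open>b\<^sup>2 (X Z + Z\<^sup>2)\<close>, so
  \<open>b\<close> becomes \<open>Z b\<^sup>2\<close>.\<close>

lemma shifted_qx_power_im: "im ((qx + 1) ^ 2 ^ n) = Z ^ (2 ^ n - 1)"
proof (induction n)
  case (Suc n)
  have "im ((qx + 1) ^ 2 ^ Suc n) = im (((qx + 1) ^ 2 ^ n) * ((qx + 1) ^ 2 ^ n))"
    by (simp only: power_Suc mult_2 power_add)
  also have "\<dots> = 2 * (re ((qx + 1) ^ 2 ^ n) * Z ^ (2 ^ n - 1)) + Z * (Z ^ (2 ^ n - 1) * Z ^ (2 ^ n - 1))"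
    unfolding quad_simps Suc by (simp only: mult_2 mult.commute)
  also have "\<dots> = Z ^ (1 + ((2 ^ n - 1) + (2 ^ n - 1)))"
    by (simp only: two_bit_poly power_add power_one_right mult_zero_left add_0)
  also have "1 + ((2 ^ n - 1) + (2 ^ n - 1)) = (2 ^ Suc n - 1 :: nat)"
    using one_le_power [of "2::nat" n] unfolding power_Suc by linarith
  finally show ?case .
qed (simp add: qx_def)


text \<open>\<open>D\<close> will be either \<open>z ^ L - 1\<close> itself, for the lower bounds on
  the orders, or \<open>Z ^ 2 ^ i\<close>, modulo which \<open>V ^ 2 ^ i\<close> is 1.\<close>

lemma cubic_ideal_quad:
  assumes "D dvd qz ^ (2 ^ i * l) - 1" "odd l"
  shows "cubic_ideal {p. D dvd p} qx qy qz i l"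
  by standard (use assms in \<open>simp_all add: two_quad quad_relations\<close>)

section \<open>Degree bounds and reduction modulo \<open>Z ^ 2 ^ i\<close>\<close>

lemma degree_Z_power: "degree (Z ^ n) = n"
  by (simp add: Z_power degree_monom_eq)

lemma degree_one_plus_Z_power_minus_1:
  assumes "n > 0"
  shows "degree ((1 + Z) ^ n - 1) = n"
proof -
  have "degree ((1 + Z) ^ n + - 1) = degree ((1 + Z) ^ n)"
    by (rule degree_add_eq_left) (simp add: degree_one_plus_Z_power assms)
  then show ?thesis by (simp add: degree_one_plus_Z_power)
qed

text \<open>This is \<open>u\<close> in the shifted variable: over bits,
  \<open>1 + z + z\<^sup>2\<close> does not change when \<open>z\<close> is replaced by
  \<open>z + 1\<close>.\<close>

definition V :: "bit poly" where "V = 1 + Z + Z\<^sup>2"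

lemma degree_V_power: "degree (V ^ n) = 2 * n"
proof -
  have "degree V = degree (Z\<^sup>2)"
    unfolding V_def by (rule degree_add_eq_right)
      (simp add: Z_def one_pCons power2_eq_square)
  then have "degree V = 2" by (simp only: degree_Z_power)
  moreover from this have "V \<noteq> 0" by auto
  ultimately show ?thesis by (simp add: degree_power_eq mult.commute)
qed

lemma V_neq_0: "V \<noteq> 0"
  using degree_V_power [of 1] by auto

lemma u_quad: "1 + qz + qz\<^sup>2 = const V"
proof -
  have "1 + (1 + Z) + (1 + Z)\<^sup>2 = V"
    by (simp add: V_def power2_eq_square algebra_simps bit_poly_double bit_poly_double')
  then show ?thesis
    by (simp add: qz_power one_quad_def const_add, simp add: qz_def const_add)
qed

text \<open>In this form \<open>V ^ 2 ^ i\<close> is visibly 1 modulo \<open>Z ^ 2 ^ i\<close>, so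
  the torsion factor disappears there.\<close>

lemma V_frobenius: "V ^ 2 ^ i = 1 + Z ^ 2 ^ i * (1 + Z ^ 2 ^ i)"
  by (simp add: V_def frobenius_char_2 [OF two_bit_poly] distrib_left add.assoc power2_eq_square
      power_mult_distrib)

lemma Z_power_dvd:
  "Z ^ 2 ^ i dvd (1 + Z) ^ (2 ^ i * l) - 1"
proof -
  have "(1 + Z) ^ 2 ^ i - 1 dvd ((1 + Z) ^ 2 ^ i) ^ l - 1"
    by (metis dvd_triv_left power_diff_1_eq)
  then show ?thesis
    by (simp add: frobenius_char_2 [OF two_bit_poly] power_mult)
qed

lemma dvd_V_mult_imp_0:
  assumes "(1 + Z) ^ L - 1 dvd V ^ n * q" "degree q + 2 * n < L"
  shows "q = 0"
proof (rule ccontr)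
  assume "q \<noteq> 0"
  then have "V ^ n * q \<noteq> 0" using V_neq_0 by simp
  then have "L \<le> degree (V ^ n * q)"
    using dvd_imp_degree_le [OF assms(1)] assms(2) degree_one_plus_Z_power_minus_1 [of L] by simp
  also have "\<dots> \<le> degree (V ^ n) + degree q" by (rule degree_mult_le)
  finally show False using assms(2) by (simp add: degree_V_power)
qed

text \<open>Modulo \<open>Z ^ 2 ^ i\<close> the torsion factor drops out, so this works for small
  \<open>l\<close> too: it settles \<open>l = 1\<close> and gives the lower bound for
  \<open>l = 3\<close>.\<close>

lemma qz_power_nontrivial_below:
  assumes "0 < m" "m < 2 ^ i"
  shows "\<not> (1 + Z) ^ (2 ^ i * l) - 1 dvd V ^ 2 ^ i * ((1 + Z) ^ m - 1)"
proof
  define q where "q = (1 + Z) ^ m - 1"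
  assume "(1 + Z) ^ (2 ^ i * l) - 1 dvd V ^ 2 ^ i * q"
  then have "Z ^ 2 ^ i dvd V ^ 2 ^ i * q"
    by (rule dvd_trans [OF Z_power_dvd])
  also have "V ^ 2 ^ i * q = q + Z ^ 2 ^ i * ((1 + Z ^ 2 ^ i) * q)"
    by (simp add: V_frobenius algebra_simps)
  finally have "Z ^ 2 ^ i dvd q"
    by (simp add: dvd_add_left_iff)
  moreover have "degree q = m" "q \<noteq> 0"
    using degree_one_plus_Z_power_minus_1 [OF assms(1)] assms(1) by (auto simp: q_def)
  ultimately show False
    using dvd_imp_degree_le [of "Z ^ 2 ^ i" q] assms(2) by (simp add: degree_Z_power)
qed

text \<open>A proper divisor of the period \<open>L\<close> is at most half of it, and
  \<open>L / 2 + 2 * 2 ^ i < L\<close> means \<open>l > 4\<close>.\<close>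

lemma qz_power_nontrivial_half:
  assumes "0 < m" "2 * m \<le> 2 ^ i * l" "5 \<le> l"
  shows "\<not> (1 + Z) ^ (2 ^ i * l) - 1 dvd V ^ 2 ^ i * ((1 + Z) ^ m - 1)"
proof
  assume *: "(1 + Z) ^ (2 ^ i * l) - 1 dvd V ^ 2 ^ i * ((1 + Z) ^ m - 1)"
  have "2 ^ i * 5 \<le> 2 ^ i * l" using assms(3) by simp
  moreover have "(0::nat) < 2 ^ i" by simp
  ultimately have "m + 2 * 2 ^ i < 2 ^ i * l" using assms(2) by linarith
  then have "(1 + Z) ^ m - 1 = 0"
    by (intro dvd_V_mult_imp_0 [OF *]) (simp add: degree_one_plus_Z_power_minus_1 assms)
  then show False
    using degree_one_plus_Z_power_minus_1 [OF assms(1)] assms(1) by simp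
qed

text \<open>All divisors of \<open>2 L\<close> other than \<open>2 L\<close> and \<open>L\<close>
  are at most \<open>2 L / 3\<close>, and \<open>2 L / 3 + 2 * 2 ^ i < L\<close> means
  \<open>l > 6\<close>.\<close>

lemma qx_power_nontrivial_below:
  assumes "0 < m" "3 * m \<le> 2 * (2 ^ i * l)" "7 \<le> l"
  shows "\<not> const ((1 + Z) ^ (2 ^ i * l) - 1) dvd const V ^ 2 ^ i * (qx ^ m - 1)"
proof
  assume "const ((1 + Z) ^ (2 ^ i * l) - 1) dvd const V ^ 2 ^ i * (qx ^ m - 1)"
  then have *: "(1 + Z) ^ (2 ^ i * l) - 1 dvd V ^ 2 ^ i * re (qx ^ m - 1)"
    "(1 + Z) ^ (2 ^ i * l) - 1 dvd V ^ 2 ^ i * im (qx ^ m - 1)"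
    by (simp_all only: const_dvd_iff const_power const_mult quad.sel)
  have "2 ^ i * 7 \<le> 2 ^ i * l" using assms(3) by simp
  moreover have "(0::nat) < 2 ^ i" by simp
  ultimately have bound: "m + 2 * 2 ^ i < 2 ^ i * l" using assms(2) by linarith
  have re_le: "degree (re (qx ^ m - 1)) \<le> m"
    using qx_power_leading [of m] by (simp add: degree_diff_le)
  have im_le: "degree (im (qx ^ m - 1)) \<le> m"
    using qx_power_leading [of m]
    by (cases "im (qx ^ m) = 0") (simp_all add: Z_def degree_mult_eq)
  have "re (qx ^ m - 1) = 0"
    by (rule dvd_V_mult_imp_0 [OF *(1)]) (use re_le bound in linarith)
  moreover have "im (qx ^ m - 1) = 0"
    by (rule dvd_V_mult_imp_0 [OF *(2)]) (use im_le bound in linarith)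
  ultimately have "qx ^ m - 1 = 0"
    by (intro quad.expand conjI) (simp_all only: quad_simps(1,2))
  then have "qx ^ m = 1" by simp
  then show False using qx_power_neq_1 assms(1) by blast
qed

text \<open>Modulo \<open>Z\<^sup>N\<close> with \<open>N = 2\<^sup>i\<close>, the element \<open>t = X\<^sup>N\<close> is a nonzero element of square zero,
  so \<open>x ^ (N l) = (1 + t) ^ l = 1 + t\<close>.\<close>

lemma qx_power_nontrivial_period:
  assumes "odd l"
  shows "\<not> const ((1 + Z) ^ (2 ^ i * l) - 1) dvd const V ^ 2 ^ i * (qx ^ (2 ^ i * l) - 1)"
proof
  define D where "D = const (Z ^ 2 ^ i)"
  define t where "t = (qx + 1) ^ 2 ^ i"
  have qz1: "qz + 1 = const Z"
    by (simp add: qz_def one_quad_def const_add bit_poly_double two_bit_poly add.commute add.left_commute)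
  have DP: "D dvd const ((1 + Z) ^ (2 ^ i * l) - 1)"
    using Z_power_dvd by (simp add: D_def const_dvd_iff)
  also have "const ((1 + Z) ^ (2 ^ i * l) - 1) = qz ^ (2 ^ i * l) - 1"
    by (simp add: qz_power one_quad_def const_diff)
  finally interpret cubic_ideal "{p. D dvd p}" qx qy qz i l
    using assms by (rule cubic_ideal_quad)
  assume "const ((1 + Z) ^ (2 ^ i * l) - 1) dvd const V ^ 2 ^ i * (qx ^ (2 ^ i * l) - 1)"
  with DP have "D dvd const V ^ 2 ^ i * (qx ^ (2 ^ i * l) - 1)"
    by (rule dvd_trans)
  then have 1: "eqv (const V ^ 2 ^ i * (qx ^ (2 ^ i * l) - 1)) 0"
    by (simp add: eqv_0_iff)
  have "(1 + D) * D \<in> {p. D dvd p}" by simp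
  moreover have "const V ^ 2 ^ i = 1 + (1 + D) * D"
    by (simp add: const_power V_frobenius D_def one_quad_def const_add const_mult mult.commute)
  ultimately have "eqv (const V ^ 2 ^ i) 1" by (simp add: eqv_def)
  then have "eqv (const V ^ 2 ^ i * (qx ^ (2 ^ i * l) - 1)) (1 * (qx ^ (2 ^ i * l) - 1))"
    by (intro eqv_mult eqv_refl)
  then have "eqv (1 * (qx ^ (2 ^ i * l) - 1)) 0"
    by (rule eqv_trans [OF eqv_sym 1])
  then have 2: "eqv (qx ^ (2 ^ i * l)) 1" by (simp add: eqv_def)
  obtain h where h: "l = 2 * h + 1" using assms by (rule oddE)
  have "eqv (t\<^sup>2) (t * D + D\<^sup>2)"
    using shifted_quadric_frobenius [of i]
    by (simp add: t_def D_def qz1 const_power mult.commute flip: power_mult)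
  also have "eqv \<dots> 0" by (simp add: eqv_0_iff power2_eq_square)
  finally have t2: "eqv (t\<^sup>2) 0" .
  have "qx ^ 2 ^ i = 1 + t"
    by (simp add: t_def frobenius_char_2 [OF two] double two add.left_commute)
  then have "qx ^ (2 ^ i * l) = (1 + t) ^ (2 * h + 1)"
    by (simp only: power_mult [of qx "2 ^ i"] h)
  also have "\<dots> = ((1 + t)\<^sup>2) ^ h * (1 + t)"
    by (simp only: power_mult power_add power_one_right)
  also have "\<dots> = (1 + t\<^sup>2) ^ h * (1 + t)" by (simp add: power2_sum two)
  also have "eqv \<dots> ((1 + 0) ^ h * (1 + t))"
    by (intro eqv_mult eqv_power eqv_add t2 eqv_refl)
  finally have "eqv (qx ^ (2 ^ i * l)) (1 + t)" by (simp only: add_0_right power_one mult_1)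
  then have "eqv (1 + t) 1"
    by (rule eqv_trans [OF eqv_sym 2])
  then have "D dvd t" by (simp add: eqv_def)
  \<comment> \<open>The coefficient of \<open>X\<close> in \<open>t\<close> misses divisibility by
    \<open>Z ^ 2 ^ i\<close> by a single factor \<open>Z\<close>.\<close>
  then have "Z ^ 2 ^ i dvd Z ^ (2 ^ i - 1)"
    by (simp only: D_def t_def const_dvd_iff shifted_qx_power_im)
  then have "degree (Z ^ 2 ^ i) \<le> degree (Z ^ (2 ^ i - 1))"
    by (rule dvd_imp_degree_le) (simp add: Z_def)
  moreover have "(0::nat) < 2 ^ i" by simp
  ultimately show False unfolding degree_Z_power by linarith
qed

section \<open>The group of created excitations\<close>

lemma odd_card_sym_diff:
  assumes "finite A" "finite B"
  shows "odd (card (sym_diff A B)) \<longleftrightarrow> odd (card A) \<noteq> odd (card B)"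
proof -
  have "card (sym_diff A B) + 2 * card (A \<inter> B) = card A + card B"
  proof -
    have "card A = card (A - B) + card (A \<inter> B)" "card B = card (B - A) + card (A \<inter> B)"
      using assms by (metis Int_commute add.commute card_Int_Diff)+
    moreover have "card (sym_diff A B) = card (A - B) + card (B - A)"
      using assms by (intro card_Un_disjoint) auto
    ultimately show ?thesis by simp
  qed
  then show ?thesis by presburger
qed

lemma odd_card_sym_diff_Collect:
  assumes "finite A" "finite B"
  shows "odd (card {a \<in> sym_diff A B. P a})
    \<longleftrightarrow> odd (card {a \<in> A. P a}) \<noteq> odd (card {a \<in> B. P a})"
proof -
  have "{a \<in> sym_diff A B. P a} = sym_diff {a \<in> A. P a} {a \<in> B. P a}" by auto
  then show ?thesis
    using assms odd_card_sym_diff [of "{a \<in> A. P a}" "{a \<in> B. P a}"] by simp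
qed

lemma image_sym_diff_inj_on:
  assumes "inj_on f C" "A \<subseteq> C" "B \<subseteq> C"
  shows "f ` sym_diff A B = sym_diff (f ` A) (f ` B)"
  using assms unfolding inj_on_def by blast

text \<open>Errors and excitations are additive for \<open>sym_diff\<close>, which therefore
  replaces insertion; keeping \<open>A \<subseteq> S\<close> preserves side conditions such as
  finiteness.\<close>

lemma finite_sym_diff_induct [consumes 1, case_names empty singleton sym_diff]:
  assumes "finite S"
    and "P {}" "\<And>a. a \<in> S \<Longrightarrow> P {a}"
    and "\<And>A B. A \<subseteq> S \<Longrightarrow> B \<subseteq> S \<Longrightarrow> P A \<Longrightarrow> P B \<Longrightarrow> P (sym_diff A B)"
  shows "P S"
proof -
  have "T \<subseteq> S \<Longrightarrow> P T" if "finite T" for T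
    using that
  proof (induction T)
    case (insert a T)
    then have "insert a T = sym_diff {a} T" by auto
    with insert show ?case using assms(3,4) by (metis insert_subset empty_subsetI)
  qed (use assms in simp)
  with assms(1) show ?thesis by simp
qed

locale cubic_code =
  fixes L :: nat
  assumes L_pos: "0 < L"
begin

lemma translate_eq: "translate L d v = (fst v + fst d, fst (snd v) + fst (snd d),
    (snd (snd v) + snd (snd d)) mod int L)"
  by (simp add: translate_def split_beta)

lemma translate_in_sites [simp]: "translate L d v \<in> sites L"
  using L_pos by (simp add: translate_eq sites_def)

lemma translate_0 [simp]: "v \<in> sites L \<Longrightarrow> translate L (0, 0, 0) v = v"
  by (auto simp: translate_eq sites_def)

lemma translate_translate: "translate L d (translate L e v) = translate L (d + e) v"
  by (simp add: translate_eq mod_simps algebra_simps split_beta)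

lemma translate_translate_inverse [simp]:
  "v \<in> sites L \<Longrightarrow> translate L (- d) (translate L d v) = v"
  "v \<in> sites L \<Longrightarrow> translate L d (translate L (- d) v) = v"
  by (simp_all add: translate_translate, simp_all add: zero_prod_def)

lemma translate_eq_iff:
  assumes "v \<in> sites L" "w \<in> sites L"
  shows "w = translate L d v \<longleftrightarrow> v = translate L (- d) w"
  using assms by (metis translate_translate_inverse)

lemma translate_generator_in [simp]: "translate_generator L d g \<in> generators L"
  by (cases g) (simp_all add: generators_def)

lemma translate_generator_translate_generator:
  "translate_generator L d (translate_generator L e g) = translate_generator L (d + e) g"
  by (cases g) (simp_all add: translate_translate)

lemma translate_generator_0 [simp]:
  "g \<in> generators L \<Longrightarrow> translate_generator L (0, 0, 0) g = g"
  by (auto simp: generators_def)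

lemma inj_on_translate_generator: "inj_on (translate_generator L d) (generators L)"
  by (rule inj_on_inverseI [of _ "translate_generator L (- d)"])
    (simp add: translate_generator_translate_generator, simp add: zero_prod_def)

text \<open>Counting modulo 2 accounts for displacements that coincide after the identification
  modulo \<open>L\<close>, for instance when \<open>L = 1\<close>.\<close>

definition cluster :: "(site \<Rightarrow> generator) \<Rightarrow> site list \<Rightarrow> site \<Rightarrow> generator set" where
  "cluster G ds w = {g. odd (count_list (map (\<lambda>d. G (translate L d w)) ds) g)}"

lemma cluster_simps [simp]:
  "cluster G [] w = {}"
  "cluster G (d # ds) w = sym_diff {G (translate L d w)} (cluster G ds w)"
  by (auto simp: cluster_def)

text \<open>These are the patterns created by a single \<open>Z\<close> on a first or second qubit,
  then by a single \<open>X\<close>. The displacements of the generators appear negated, since a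
  qubit at \<open>w\<close> belongs to the generators located at \<open>w - d\<close>.\<close>

definition stencils :: "((site \<Rightarrow> generator) \<times> site list) set" where
  "stencils =
    {(XGen, [(0, 0, 0), (-1, -1, 0), (0, -1, -1), (-1, 0, -1)]),
     (XGen, [(0, 0, 0), (-1, 0, 0), (0, -1, 0), (0, 0, -1)]),
     (ZGen, [(-1, -1, -1), (-1, -1, 0), (0, -1, -1), (-1, 0, -1)]),
     (ZGen, [(-1, -1, -1), (-1, 0, 0), (0, -1, 0), (0, 0, -1)])}"

lemma finite_cluster [simp]: "finite (cluster G ds w)"
  by (induction ds) simp_all

lemma cluster_subset_generators:
  assumes "G = XGen \<or> G = ZGen"
  shows "cluster G ds w \<subseteq> generators L"
proof (induction ds)
  case (Cons d ds)
  have "G (translate L d w) \<in> generators L"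
    using assms by (auto simp: generators_def)
  with Cons show ?case by auto
qed simp

lemma pauli_prod_map:
  "pauli_prod (map pauli_X qs) = ({q. odd (count_list qs q)}, {})"
  "pauli_prod (map pauli_Z qs) = ({}, {q. odd (count_list qs q)})"
  by (induction qs) (auto simp: pauli_prod_def pauli_mult_def pauli_X_def pauli_Z_def)

lemma violated_pauli_Z:
  "violated L (pauli_Z q) = {XGen v |v. v \<in> sites L \<and> q \<in> fst (generator_op L (XGen v))}"
proof -
  have "odd (card ({q} \<inter> A)) \<longleftrightarrow> q \<in> A" for A
    by (cases "q \<in> A") auto
  then show ?thesis
    by (auto simp: violated_def anticommute_def pauli_Z_def generators_def pauli_prod_map
        simp del: generator_op.simps) (auto simp: pauli_prod_def pauli_mult_def pauli_Z_def)
qed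

lemma violated_pauli_X:
  "violated L (pauli_X q) = {ZGen v |v. v \<in> sites L \<and> q \<in> snd (generator_op L (ZGen v))}"
proof -
  have "odd (card ({q} \<inter> A)) \<longleftrightarrow> q \<in> A" for A
    by (cases "q \<in> A") auto
  then show ?thesis
    by (auto simp: violated_def anticommute_def pauli_X_def generators_def pauli_prod_map
        simp del: generator_op.simps) (auto simp: pauli_prod_def pauli_mult_def pauli_X_def)
qed

lemma count_list_translate:
  assumes "inj Q" "inj G" "v \<in> sites L" "w \<in> sites L"
  shows "count_list (map (\<lambda>d. Q (translate L d v)) ds) (Q w)
    = count_list (map (\<lambda>d. G (translate L d w)) (map uminus ds)) (G v)"
proof -
  have "Q (translate L d v) = Q w \<longleftrightarrow> G (translate L (- d) w) = G v" for d
    using translate_eq_iff [OF assms(3,4), of d] inj_eq [OF assms(1)] inj_eq [OF assms(2)] by metis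
  then show ?thesis by (induction ds) simp_all
qed

lemma generator_op_eq:
  "generator_op L (XGen v) = pauli_prod (map pauli_X
     (map (\<lambda>d. First (translate L d v)) [(0, 0, 0), (1, 1, 0), (0, 1, 1), (1, 0, 1)] @
      map (\<lambda>d. Second (translate L d v)) [(0, 0, 0), (1, 0, 0), (0, 1, 0), (0, 0, 1)]))"
  "generator_op L (ZGen v) = pauli_prod (map pauli_Z
     (map (\<lambda>d. First (translate L d v)) [(1, 1, 1), (1, 1, 0), (0, 1, 1), (1, 0, 1)] @
      map (\<lambda>d. Second (translate L d v)) [(1, 1, 1), (1, 0, 0), (0, 1, 0), (0, 0, 1)]))"
  by simp_all

text \<open>The two forms cover the two positions of the list that can contain the qubit: a
  generator lists its first qubits before its second ones.\<close>

lemma violated_single_aux: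
  assumes "w \<in> sites L" "inj Q" "inj G" "\<And>v w. Q v \<noteq> Q' w"
  shows "{G v |v. v \<in> sites L \<and> odd (count_list (map (\<lambda>d. Q (translate L d v)) ds @
      map (\<lambda>d. Q' (translate L d v)) ds') (Q w))} = cluster G (map uminus ds) w"
    and "{G v |v. v \<in> sites L \<and> odd (count_list (map (\<lambda>d. Q' (translate L d v)) ds' @
      map (\<lambda>d. Q (translate L d v)) ds) (Q w))} = cluster G (map uminus ds) w"
proof -
  have 0: "count_list (map (\<lambda>d. Q' (translate L d v)) ds') (Q w) = 0" for v
    by (intro count_notin) (simp add: image_iff assms(4))
  have "g \<in> G ` sites L" if "g \<in> cluster G (map uminus ds) w" for g
  proof -
    have "count_list (map (\<lambda>d. G (translate L d w)) (map uminus ds)) g \<noteq> 0"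
      using that odd_pos unfolding cluster_def by blast
    then have "g \<in> set (map (\<lambda>d. G (translate L d w)) (map uminus ds))"
      by (metis count_notin)
    then show ?thesis by auto
  qed
  then have "{G v |v. v \<in> sites L \<and> odd (count_list (map (\<lambda>d. Q (translate L d v)) ds) (Q w))}
      = cluster G (map uminus ds) w"
    using count_list_translate [OF assms(2,3) _ assms(1), of _ ds]
    by (fastforce simp: cluster_def)
  then show "{G v |v. v \<in> sites L \<and> odd (count_list (map (\<lambda>d. Q (translate L d v)) ds @
      map (\<lambda>d. Q' (translate L d v)) ds') (Q w))} = cluster G (map uminus ds) w"
    and "{G v |v. v \<in> sites L \<and> odd (count_list (map (\<lambda>d. Q' (translate L d v)) ds' @
      map (\<lambda>d. Q (translate L d v)) ds) (Q w))} = cluster G (map uminus ds) w"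
    by (simp_all add: 0)
qed

lemma violated_single:
  assumes "w \<in> sites L"
  shows "violated L (pauli_Z (First w)) = cluster XGen [(0, 0, 0), (-1, -1, 0), (0, -1, -1), (-1, 0, -1)] w"
    and "violated L (pauli_Z (Second w)) = cluster XGen [(0, 0, 0), (-1, 0, 0), (0, -1, 0), (0, 0, -1)] w"
    and "violated L (pauli_X (First w)) = cluster ZGen [(-1, -1, -1), (-1, -1, 0), (0, -1, -1), (-1, 0, -1)] w"
    and "violated L (pauli_X (Second w)) = cluster ZGen [(-1, -1, -1), (-1, 0, 0), (0, -1, 0), (0, 0, -1)] w"
  unfolding violated_pauli_X violated_pauli_Z generator_op_eq pauli_prod_map fst_conv snd_conv
    mem_Collect_eq
  by (subst violated_single_aux; (auto simp: inj_def assms simp del: cluster_simps; fail)?;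
      simp del: cluster_simps)+

lemma anticommute_pauli_mult:
  assumes "finite (fst P)" "finite (snd P)" "finite (fst Q)" "finite (snd Q)"
  shows "anticommute (pauli_mult P Q) R \<longleftrightarrow> anticommute P R \<noteq> anticommute Q R"
  using odd_card_sym_diff_Collect [OF assms(1,3), of "\<lambda>q. q \<in> snd R"]
    odd_card_sym_diff_Collect [OF assms(2,4), of "\<lambda>q. q \<in> fst R"]
  unfolding anticommute_def pauli_mult_def fst_conv snd_conv Int_def by auto

lemma violated_pauli_mult:
  assumes "finite (fst P)" "finite (snd P)" "finite (fst Q)" "finite (snd Q)"
  shows "violated L (pauli_mult P Q) = sym_diff (violated L P) (violated L Q)"
  by (auto simp: violated_def anticommute_pauli_mult [OF assms])

lemma violated_empty [simp]: "violated L ({}, {}) = {}"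
  by (auto simp: violated_def anticommute_def)

lemma created_sym_diff:
  assumes "S \<in> created L" "T \<in> created L"
  shows "sym_diff S T \<in> created L"
proof -
  obtain P Q where P: "P \<in> pauli_operators L" "S = violated L P"
    and Q: "Q \<in> pauli_operators L" "T = violated L Q"
    using assms by (auto simp: created_def)
  then have "sym_diff S T = violated L (pauli_mult P Q)"
    by (subst violated_pauli_mult) (auto simp: pauli_operators_def)
  moreover have "pauli_mult P Q \<in> pauli_operators L"
    using P(1) Q(1) by (auto simp: pauli_operators_def pauli_mult_def)
  ultimately show ?thesis by (simp add: created_def)
qed

lemma empty_created: "{} \<in> created L"
  unfolding created_def
  by (rule image_eqI [of _ _ "({}, {})"]) (simp_all add: pauli_operators_def)

lemma cluster_created:
  assumes "(G, ds) \<in> stencils" "w \<in> sites L"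
  shows "cluster G ds w \<in> created L"
proof -
  have "pauli_X q \<in> pauli_operators L" "pauli_Z q \<in> pauli_operators L" if "q \<in> qubits L" for q
    using that by (auto simp: pauli_operators_def pauli_X_def pauli_Z_def)
  moreover have "First w \<in> qubits L" "Second w \<in> qubits L"
    using assms(2) by (auto simp: qubits_def)
  ultimately show ?thesis
    using assms(1) unfolding created_def stencils_def
    by (auto simp: violated_single [OF assms(2), symmetric] simp del: cluster_simps)
qed

text \<open>Modulo phases every Pauli operator is a product of single-qubit \<open>X\<close> and
  \<open>Z\<close> factors, so the created sets are the span of the clusters.\<close>

lemma created_induct [consumes 1, case_names empty sym_diff cluster]:
  assumes "S \<in> created L"
    and empty: "P {}"
    and diff: "\<And>S T. S \<in> created L \<Longrightarrow> T \<in> created L \<Longrightarrow> P S \<Longrightarrow> P T \<Longrightarrow> P (sym_diff S T)"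
    and cluster: "\<And>G ds w. (G, ds) \<in> stencils \<Longrightarrow> w \<in> sites L \<Longrightarrow> P (cluster G ds w)"
  shows "P S"
proof -
  obtain A B where AB: "finite A" "A \<subseteq> qubits L" "finite B" "B \<subseteq> qubits L" "S = violated L (A, B)"
    using assms(1) by (auto simp: created_def pauli_operators_def)
  have stencil: "P (violated L (pauli_X q)) \<and> P (violated L (pauli_Z q))" if "q \<in> qubits L" for q
    using that cluster
    by (auto simp: qubits_def violated_single stencils_def simp del: cluster_simps)
  have A: "P (violated L (A, {}))"
    using AB(1)
  proof (induction rule: finite_sym_diff_induct)
    case (singleton q)
    then show ?case using stencil [of q] AB(2) by (auto simp: pauli_X_def)
  next
    case (sym_diff A' A'')
    have fin: "finite A'" "finite A''" using sym_diff AB(1) finite_subset by blast+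
    then have "violated L (A', {}) \<in> created L" "violated L (A'', {}) \<in> created L"
      using sym_diff AB(2) by (auto simp: created_def pauli_operators_def)
    then have "P (sym_diff (violated L (A', {})) (violated L (A'', {})))"
      using sym_diff diff by blast
    then show ?case using fin by (simp add: pauli_mult_def flip: violated_pauli_mult)
  qed (simp add: empty)
  have B: "P (violated L ({}, B))"
    using AB(3)
  proof (induction rule: finite_sym_diff_induct)
    case (singleton q)
    then show ?case using stencil [of q] AB(4) by (auto simp: pauli_Z_def)
  next
    case (sym_diff A' A'')
    have fin: "finite A'" "finite A''" using sym_diff AB(3) finite_subset by blast+
    then have "violated L ({}, A') \<in> created L" "violated L ({}, A'') \<in> created L"
      using sym_diff AB(4) by (auto simp: created_def pauli_operators_def)
    then have "P (sym_diff (violated L ({}, A')) (violated L ({}, A'')))"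
      using sym_diff diff by blast
    then show ?case using fin by (simp add: pauli_mult_def flip: violated_pauli_mult)
  qed (simp add: empty)
  have "violated L (A, {}) \<in> created L" "violated L ({}, B) \<in> created L"
    using AB by (auto simp: created_def pauli_operators_def)
  then have "P (sym_diff (violated L (A, {})) (violated L ({}, B)))"
    using A B diff by blast
  moreover have "sym_diff (violated L (A, {})) (violated L ({}, B)) = S"
    using AB by (simp add: pauli_mult_def flip: violated_pauli_mult)
  ultimately show ?thesis by simp
qed

lemma created_subset: "S \<in> created L \<Longrightarrow> finite S \<and> S \<subseteq> generators L"
proof (induction rule: created_induct)
  case (cluster G ds w)
  then have "G = XGen \<or> G = ZGen" by (auto simp: stencils_def)
  then show ?case by (simp add: cluster_subset_generators)
qed auto

lemma translate_created: "S \<in> created L \<Longrightarrow> translate_generator L e ` S \<in> created L"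
proof (induction rule: created_induct)
  case (cluster G ds w)
  then have G: "G = XGen \<or> G = ZGen" by (auto simp: stencils_def)
  have "translate_generator L e ` cluster G ds w = cluster G ds (translate L e w)" for ds
  proof (induction ds)
    case (Cons d ds)
    have "{G (translate L d w)} \<subseteq> generators L" using G by (auto simp: generators_def)
    then show ?case
      unfolding cluster_simps
      using Cons cluster_subset_generators [OF G] G
      by (subst image_sym_diff_inj_on [OF inj_on_translate_generator])
        (auto simp: translate_translate add.commute)
  qed simp
  then show ?case using cluster by (simp add: cluster_created)
next
  case (sym_diff S T)
  then show ?case
    using created_subset created_sym_diff
    by (subst image_sym_diff_inj_on [OF inj_on_translate_generator]) auto
qed (simp add: empty_created)

end

section \<open>Anyon types as cosets\<close>

context cubic_code
begin

definition coset :: "generator set \<Rightarrow> generator set set" where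
  "coset S = (\<lambda>h. sym_diff h S) ` created L"

lemma carrier_anyon_group: "carrier (anyon_group L) = coset ` {S. finite S \<and> S \<subseteq> generators L}"
  by (auto simp: anyon_group_def FactGroup_def RCOSETS_def r_coset_def excitation_group_def coset_def)

lemma coset_eq_iff: "coset S = coset T \<longleftrightarrow> sym_diff S T \<in> created L"
proof
  assume "coset S = coset T"
  moreover have "sym_diff {} S \<in> coset S"
    unfolding coset_def using empty_created by (rule imageI)
  ultimately obtain h where "h \<in> created L" "sym_diff {} S = sym_diff h T"
    by (auto simp: coset_def)
  moreover from this have "sym_diff S T = h" by blast
  ultimately show "sym_diff S T \<in> created L" by simp
next
  have sub: "coset A \<subseteq> coset B" if "sym_diff A B \<in> created L" for A B
  proof
    fix T assume "T \<in> coset A"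
    then obtain h where h: "h \<in> created L" "T = sym_diff h A" by (auto simp: coset_def)
    then have "T = sym_diff (sym_diff h (sym_diff A B)) B" by blast
    then show "T \<in> coset B"
      unfolding coset_def using created_sym_diff [OF h(1) that] by (rule image_eqI)
  qed
  assume *: "sym_diff S T \<in> created L"
  moreover have "sym_diff T S = sym_diff S T" by blast
  ultimately show "coset S = coset T" using sub [of S T] sub [of T S] by auto
qed

lemma anyon_translation_coset:
  assumes "S \<subseteq> generators L"
  shows "anyon_translation L d (coset S) = coset (translate_generator L d ` S)"
proof -
  let ?T = "\<lambda>e A. translate_generator L e ` A"
  have T: "?T e (sym_diff h S) = sym_diff (?T e h) (?T e S)" if "h \<in> created L" for h e
    using created_subset [OF that] assms
    by (intro image_sym_diff_inj_on [OF inj_on_translate_generator]) auto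
  have "?T d ` created L = created L"
  proof
    show "?T d ` created L \<subseteq> created L" using translate_created by blast
    show "created L \<subseteq> ?T d ` created L"
    proof
      fix h assume h: "h \<in> created L"
      then have "g \<in> generators L" if "g \<in> h" for g using created_subset that by blast
      then have "?T d (?T (- d) h) = h"
        by (simp add: image_image translate_generator_translate_generator)
          (simp add: zero_prod_def)
      then show "h \<in> ?T d ` created L"
        using translate_created [OF h] by (metis imageI)
    qed
  qed
  then have "coset (?T d S) = (\<lambda>h. sym_diff h (?T d S)) ` ?T d ` created L"
    by (simp add: coset_def)
  then show ?thesis
    by (simp add: anyon_translation_def coset_def image_image T)
qed

section \<open>Powers of translations and divisibility of their orders\<close>

fun multiple :: "nat \<Rightarrow> site \<Rightarrow> site" where
  "multiple m (a, b, c) = (int m * a, int m * b, int m * c)"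

lemma anyon_translation_power_coset:
  assumes "S \<subseteq> generators L"
  shows "(anyon_translation L d ^^ m) (coset S) = coset (translate_generator L (multiple m d) ` S)"
proof (induction m)
  case 0
  have "g \<in> generators L" if "g \<in> S" for g using assms that by blast
  then have "translate_generator L (multiple 0 d) ` S = S" by (cases d) simp
  then show ?case by simp
next
  case (Suc m)
  have "d + multiple m d = multiple (Suc m) d"
    by (cases d) (simp add: algebra_simps)
  then have "translate_generator L d ` translate_generator L (multiple m d) ` S
      = translate_generator L (multiple (Suc m) d) ` S"
    by (simp add: image_image translate_generator_translate_generator)
  moreover have "translate_generator L (multiple m d) ` S \<subseteq> generators L" by auto
  ultimately show ?case by (simp add: Suc anyon_translation_coset)
qed

text \<open>Single generators span the excitations, so by additivity it is enough to compare each of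
  them with its translate.\<close>

definition acts_trivially :: "site \<Rightarrow> bool" where
  "acts_trivially d \<longleftrightarrow> (\<forall>g\<in>generators L. sym_diff {translate_generator L d g} {g} \<in> created L)"

lemma sym_diff_translate_created:
  assumes "acts_trivially d" "finite S" "S \<subseteq> generators L"
  shows "sym_diff (translate_generator L d ` S) S \<in> created L"
  using assms(2)
proof (induction rule: finite_sym_diff_induct)
  case (singleton g)
  then show ?case using assms unfolding acts_trivially_def by auto
next
  case (sym_diff A B)
  have "translate_generator L d ` sym_diff A B
      = sym_diff (translate_generator L d ` A) (translate_generator L d ` B)"
    using sym_diff assms by (intro image_sym_diff_inj_on [OF inj_on_translate_generator]) auto
  then have "sym_diff (translate_generator L d ` sym_diff A B) (sym_diff A B)
      = sym_diff (sym_diff (translate_generator L d ` A) A) (sym_diff (translate_generator L d ` B) B)"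
    by (simp only:) blast
  then show ?case using created_sym_diff [OF sym_diff(3,4)] by simp
qed (simp add: empty_created)

lemma anyon_translation_power_trivial_iff:
  "(\<forall>a\<in>carrier (anyon_group L). (anyon_translation L d ^^ m) a = a) \<longleftrightarrow>
    acts_trivially (multiple m d)"
proof
  assume *: "\<forall>a\<in>carrier (anyon_group L). (anyon_translation L d ^^ m) a = a"
  show "acts_trivially (multiple m d)"
    unfolding acts_trivially_def
  proof
    fix g assume g: "g \<in> generators L"
    then have "(anyon_translation L d ^^ m) (coset {g}) = coset {g}"
      using * by (simp add: carrier_anyon_group)
    with g show "sym_diff {translate_generator L (multiple m d) g} {g} \<in> created L"
      by (simp add: anyon_translation_power_coset coset_eq_iff)
  qed
next
  assume "acts_trivially (multiple m d)"
  then show "\<forall>a\<in>carrier (anyon_group L). (anyon_translation L d ^^ m) a = a"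
    by (auto simp: carrier_anyon_group anyon_translation_power_coset coset_eq_iff
        sym_diff_translate_created simp del: Un_iff)
qed

lemma translation_order_eq:
  "translation_order L d = (LEAST m. 0 < m \<and> acts_trivially (multiple m d))"
  unfolding translation_order_def anyon_translation_power_trivial_iff ..

lemma translation_order_trivial:
  assumes "0 < m" "acts_trivially (multiple m d)"
  shows "0 < translation_order L d" "acts_trivially (multiple (translation_order L d) d)"
  using LeastI [of "\<lambda>m. 0 < m \<and> acts_trivially (multiple m d)" m] assms
  unfolding translation_order_eq by auto

lemma acts_trivially_dvd:
  assumes "acts_trivially (multiple m d)" "m dvd n"
  shows "acts_trivially (multiple n d)"
proof -
  obtain j where n: "n = m * j" using assms(2) by blast
  have "((anyon_translation L d ^^ m) ^^ j) a = a" if "a \<in> carrier (anyon_group L)" for a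
    using assms(1) that unfolding anyon_translation_power_trivial_iff [symmetric]
    by (induction j) auto
  then show ?thesis
    by (simp add: n funpow_mult flip: anyon_translation_power_trivial_iff)
qed

lemma translation_order_dvd:
  assumes "0 < m" "acts_trivially (multiple m d)"
  shows "translation_order L d dvd m"
proof -
  define n where "n = translation_order L d"
  have n: "0 < n" "acts_trivially (multiple n d)"
    using translation_order_trivial [OF assms] by (simp_all add: n_def)
  have "(anyon_translation L d ^^ (m mod n)) a = a" if a: "a \<in> carrier (anyon_group L)" for a
  proof -
    have "acts_trivially (multiple (n * (m div n)) d)"
      by (rule acts_trivially_dvd [OF n(2)]) simp
    then have "(anyon_translation L d ^^ (n * (m div n))) a = a"
      using a by (simp flip: anyon_translation_power_trivial_iff)
    then have "(anyon_translation L d ^^ (m mod n)) a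
        = (anyon_translation L d ^^ (m mod n)) ((anyon_translation L d ^^ (n * (m div n))) a)"
      by simp
    also have "\<dots> = (anyon_translation L d ^^ m) a"
      by (metis comp_apply funpow_add mod_mult_div_eq)
    also have "\<dots> = a"
      using assms(2) a by (simp flip: anyon_translation_power_trivial_iff)
    finally show ?thesis .
  qed
  then have "acts_trivially (multiple (m mod n) d)"
    by (simp flip: anyon_translation_power_trivial_iff)
  moreover have "m mod n < n" using n(1) by simp
  ultimately have "m mod n = 0"
    using not_less_Least [of "m mod n" "\<lambda>m. 0 < m \<and> acts_trivially (multiple m d)"]
    unfolding n_def translation_order_eq by auto
  then show ?thesis by (simp add: n_def dvd_eq_mod_eq_0)
qed

section \<open>The symmetry exchanging \<open>x\<close> and \<open>y\<close>\<close>

fun swap_site :: "site \<Rightarrow> site" where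
  "swap_site (a, b, c) = (b, a, c)"

fun swap_generator :: "generator \<Rightarrow> generator" where
  "swap_generator (XGen v) = XGen (swap_site v)"
| "swap_generator (ZGen v) = ZGen (swap_site v)"

lemma swap_swap [simp]: "swap_generator (swap_generator g) = g"
proof -
  have "swap_site (swap_site v) = v" for v by (cases v) simp
  then show ?thesis by (cases g) simp_all
qed

lemma swap_translate: "swap_site (translate L d v) = translate L (swap_site d) (swap_site v)"
  by (cases d; cases v) (simp add: translate_def)

lemma swap_site_in [simp]: "swap_site v \<in> sites L \<longleftrightarrow> v \<in> sites L"
  by (cases v) (simp add: sites_def)

lemma in_generators_iff [simp]:
  "XGen v \<in> generators L \<longleftrightarrow> v \<in> sites L"
  "ZGen v \<in> generators L \<longleftrightarrow> v \<in> sites L"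
  by (auto simp: generators_def)

lemma swap_created: "S \<in> created L \<Longrightarrow> swap_generator ` S \<in> created L"
proof (induction rule: created_induct)
  case (cluster G ds w)
  have inj: "inj swap_generator" by (rule injI) (metis swap_swap)
  have "swap_generator ` cluster G ds' w = cluster G (map swap_site ds') (swap_site w)" for ds'
  proof (induction ds')
    case (Cons d ds')
    moreover have "swap_generator (G v) = G (swap_site v)" for v
      using cluster(1) by (auto simp: stencils_def)
    ultimately show ?case
      unfolding cluster_simps list.map by (subst image_sym_diff_inj_on [OF inj]) (simp_all add: swap_translate)
  qed simp
  \<comment> \<open>The swap only reorders each stencil, and a cluster depends on multiplicities
    alone.\<close>
  moreover have "mset (map swap_site ds) = mset ds"
    using cluster(1) by (auto simp: stencils_def)
  then have "cluster G (map swap_site ds) v = cluster G ds v" for v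
    by (simp only: cluster_def flip: count_mset mset_map) (simp only: mset_map)
  ultimately show ?case using cluster by (simp add: cluster_created del: cluster_simps)
next
  case (sym_diff S T)
  have inj: "inj swap_generator" by (rule injI) (metis swap_swap)
  show ?case
    using created_sym_diff [OF sym_diff(3,4)] by (subst image_sym_diff_inj_on [OF inj]) auto
qed (simp add: empty_created)

lemma acts_trivially_swap:
  assumes "acts_trivially d"
  shows "acts_trivially (swap_site d)"
  unfolding acts_trivially_def
proof
  fix g assume "g \<in> generators L"
  then have "swap_generator g \<in> generators L" by (cases g) simp_all
  then have "swap_generator ` sym_diff {translate_generator L d (swap_generator g)} {swap_generator g}
      \<in> created L"
    using assms unfolding acts_trivially_def by (intro swap_created) blast
  moreover have "inj swap_generator" by (rule injI) (metis swap_swap)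
  moreover have "swap_generator (translate_generator L d (swap_generator g))
      = translate_generator L (swap_site d) g"
    by (cases g; rename_tac v; case_tac v) (simp_all add: swap_translate)
  ultimately show "sym_diff {translate_generator L (swap_site d) g} {g} \<in> created L"
    by (simp add: image_sym_diff_inj_on [of swap_generator UNIV])
qed

lemma order_x_eq_order_y: "order_x L = order_y L"
proof -
  have "acts_trivially (multiple m (1, 0, 0)) \<longleftrightarrow> acts_trivially (multiple m (0, 1, 0))" for m
    using acts_trivially_swap [of "multiple m (1, 0, 0)"]
      acts_trivially_swap [of "multiple m (0, 1, 0)"] by auto
  then show ?thesis by (simp only: translation_order_eq)
qed


section \<open>Laurent polynomials\<close>

text \<open>A monomial stands for the translate of the generator at the origin. Exponents that agree
  modulo \<open>L\<close> in the last coordinate name the same generator, hence the parity of a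
  count.\<close>

definition excitation :: "(site \<Rightarrow> generator) \<Rightarrow> (site \<Rightarrow>\<^sub>0 bit) \<Rightarrow> generator set" where
  "excitation G p = {g. odd (card {w \<in> Poly_Mapping.keys p. G (translate L w (0, 0, 0)) = g})}"

lemma keys_add_bit: "Poly_Mapping.keys (p + q) = sym_diff (Poly_Mapping.keys p) (Poly_Mapping.keys q)" for p q :: "site \<Rightarrow>\<^sub>0 bit"
proof (rule Set.set_eqI)
  fix w
  show "w \<in> Poly_Mapping.keys (p + q) \<longleftrightarrow> w \<in> sym_diff (Poly_Mapping.keys p) (Poly_Mapping.keys q)"
    by (cases "Poly_Mapping.lookup p w"; cases "Poly_Mapping.lookup q w") (simp_all add: in_keys_iff lookup_add)
qed

lemma excitation_0 [simp]: "excitation G 0 = {}"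
  by (simp add: excitation_def)

lemma excitation_add: "excitation G (p + q) = sym_diff (excitation G p) (excitation G q)"
  by (auto simp: excitation_def keys_add_bit odd_card_sym_diff_Collect simp del: Un_iff)

lemma excitation_single: "excitation G (Poly_Mapping.single w 1) = {G (translate L w (0, 0, 0))}"
proof -
  have "odd (card {v. v = w \<and> G (translate L v (0, 0, 0)) = g}) \<longleftrightarrow> g = G (translate L w (0, 0, 0))" for g
    by (cases "g = G (translate L w (0, 0, 0))") (auto simp: conj_commute cong: conj_cong)
  then show ?thesis by (auto simp: excitation_def)
qed

lemma laurent_induct [case_names zero single add]:
  fixes p :: "site \<Rightarrow>\<^sub>0 bit"
  assumes "P 0" "\<And>w. P (Poly_Mapping.single w 1)" "\<And>p q. P p \<Longrightarrow> P q \<Longrightarrow> P (p + q)"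
  shows "P p"
proof (induction p rule: update_induct)
  case (update p w b)
  have "Poly_Mapping.update w b p = Poly_Mapping.single w 1 + p"
    using update(1,2)
    by (intro poly_mapping_eqI) (auto simp: lookup_update lookup_add lookup_single in_keys_iff when_def)
  then show ?case using assms(2,3) update(3) by simp
qed (fact assms)

lemma excitation_cluster:
  "excitation G (\<Sum>d\<leftarrow>ds. Poly_Mapping.single d 1) = cluster G ds (0, 0, 0)"
  by (induction ds) (simp_all add: excitation_add excitation_single)

lemma excitation_single_mult:
  assumes "G = XGen \<or> G = ZGen"
  shows "excitation G (Poly_Mapping.single w 1 * p) = translate_generator L w ` excitation G p"
proof (induction p rule: laurent_induct)
  case (single v)
  then show ?case
    using assms by (auto simp: mult_single excitation_single translate_translate)
next
  case (add p q)
  have "excitation G p \<subseteq> generators L" for p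
  proof (induction p rule: laurent_induct)
    case (single w)
    then show ?case using assms by (auto simp: excitation_single)
  qed (auto simp: excitation_add)
  then show ?case
    unfolding distrib_left excitation_add add
    by (intro image_sym_diff_inj_on [OF inj_on_translate_generator, symmetric])
qed simp

definition relations :: "(site \<Rightarrow> generator) \<Rightarrow> (site \<Rightarrow>\<^sub>0 bit) set" where
  "relations G = {p. excitation G p \<in> created L}"

lemma relations_add: "p \<in> relations G \<Longrightarrow> q \<in> relations G \<Longrightarrow> p + q \<in> relations G"
  by (simp add: relations_def excitation_add created_sym_diff)

lemma relations_0: "0 \<in> relations G"
  by (simp add: relations_def empty_created)

lemma relations_mult:
  assumes "G = XGen \<or> G = ZGen" "p \<in> relations G"
  shows "r * p \<in> relations G"
proof (induction r rule: laurent_induct)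
  case (single w)
  then show ?case
    using assms by (simp add: relations_def excitation_single_mult translate_created)
qed (simp_all add: relations_0 relations_add distrib_right)

lemma relations_stencil:
  assumes "(G, ds) \<in> stencils"
  shows "(\<Sum>d\<leftarrow>ds. Poly_Mapping.single d 1) \<in> relations G"
proof -
  have "(0, 0, 0) \<in> sites L" using L_pos by (simp add: sites_def)
  then show ?thesis
    unfolding relations_def mem_Collect_eq excitation_cluster
    using assms by (rule cluster_created [rotated])
qed

lemma two_laurent: "(2 :: site \<Rightarrow>\<^sub>0 bit) = 0"
  using single_numeral [of "num.Bit0 num.One", where 'a = site and 'b = bit] by simp

lemma diff_laurent: "p - q = p + q" for p q :: "site \<Rightarrow>\<^sub>0 bit"
proof -
  have "q + q = 0" by (metis two_laurent mult_2 mult_zero_left)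
  then show ?thesis by (simp add: diff_eq_eq add.assoc)
qed

lemma acts_trivially_if_relations:
  assumes "Poly_Mapping.single d 1 - 1 \<in> relations XGen" "Poly_Mapping.single d 1 - 1 \<in> relations ZGen"
  shows "acts_trivially d"
  unfolding acts_trivially_def
proof
  fix g assume "g \<in> generators L"
  then obtain G v where G: "G = XGen \<or> G = ZGen" and g: "g = G v" and v: "v \<in> sites L"
    by (auto simp: generators_def)
  \<comment> \<open>Multiplication by the monomial of \<open>v\<close> moves the relation from the
    origin to the generator at \<open>v\<close>.\<close>
  have "Poly_Mapping.single v 1 * (Poly_Mapping.single d 1 + 1) \<in> relations G"
    using assms G relations_mult [OF G] unfolding diff_laurent by auto
  then have "excitation G (Poly_Mapping.single (d + v) 1 + Poly_Mapping.single v 1) \<in> created L"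
    by (simp add: distrib_left mult_single relations_def add.commute)
  moreover have "translate L (d + v) (0, 0, 0) = translate L d (translate L v (0, 0, 0))"
    by (simp add: translate_translate)
  moreover have "translate L v (0, 0, 0) = v"
    using v by (auto simp: translate_eq sites_def)
  ultimately show "sym_diff {translate_generator L d g} {g} \<in> created L"
    using G by (auto simp: excitation_add excitation_single g)
qed

abbreviation laurent :: "int \<Rightarrow> int \<Rightarrow> int \<Rightarrow> site \<Rightarrow>\<^sub>0 bit" where
  "laurent a b c \<equiv> Poly_Mapping.single (a, b, c) 1"

lemma laurent_0: "laurent 0 0 0 = 1"
  using single_one [where 'a = site] by (simp add: zero_prod_def)

lemma laurent_mult: "laurent a b c * laurent a' b' c' = laurent (a + a') (b + b') (c + c')"
  by (simp add: mult_single)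

lemma laurent_power: "laurent a b c ^ n = laurent (int n * a) (int n * b) (int n * c)"
  by (induction n) (simp_all add: laurent_0 laurent_mult algebra_simps)

text \<open>Errors displace \<open>X\<close>-type excitations by the inverses of the displacements appearing in the
  generators; for \<open>Z\<close>-type excitations the factor \<open>x y z\<close> turns these back into monomials in
  \<open>x, y, z\<close>.\<close>

lemma cubic_ideal_relations:
  assumes "L = 2 ^ i * l" "odd l"
  shows "cubic_ideal (relations XGen) (laurent (-1) 0 0) (laurent 0 (-1) 0) (laurent 0 0 (-1)) i l"
    and "cubic_ideal (relations ZGen) (laurent 1 0 0) (laurent 0 1 0) (laurent 0 0 1) i l"
proof -
  have period: "laurent 0 0 c - 1 \<in> relations G" if "c = int L \<or> c = - int L" for G c
    using that by (auto simp: relations_def diff_laurent excitation_add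
        excitation_single translate_eq empty_created simp flip: laurent_0)
  show "cubic_ideal (relations XGen) (laurent (-1) 0 0) (laurent 0 (-1) 0) (laurent 0 0 (-1)) i l"
  proof
    show "1 + laurent (-1) 0 0 + laurent 0 (-1) 0 + laurent 0 0 (-1) \<in> relations XGen"
      using relations_stencil [of XGen "[(0, 0, 0), (-1, 0, 0), (0, -1, 0), (0, 0, -1)]"]
      by (simp add: stencils_def laurent_0 add.assoc)
    show "1 + laurent (-1) 0 0 * laurent 0 (-1) 0 + laurent 0 (-1) 0 * laurent 0 0 (-1)
        + laurent 0 0 (-1) * laurent (-1) 0 0 \<in> relations XGen"
      using relations_stencil [of XGen "[(0, 0, 0), (-1, -1, 0), (0, -1, -1), (-1, 0, -1)]"]
      by (simp add: stencils_def laurent_0 laurent_mult add.assoc)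
    show "laurent 0 0 (-1) ^ (2 ^ i * l) - 1 \<in> relations XGen"
      using period [of "- int L"] assms by (simp add: laurent_power)
  qed (simp_all add: relations_0 relations_add relations_mult two_laurent assms(2))
  show "cubic_ideal (relations ZGen) (laurent 1 0 0) (laurent 0 1 0) (laurent 0 0 1) i l"
  proof
    \<comment> \<open>Compared with \<open>XGen\<close> the two qubits exchange roles: after
      multiplication by \<open>x y z\<close> the first qubit yields the linear relation and the
      second the quadratic one.\<close>
    show "1 + laurent 1 0 0 + laurent 0 1 0 + laurent 0 0 1 \<in> relations ZGen"
      using relations_mult [OF disjI2 [OF refl] relations_stencil
          [of ZGen "[(-1, -1, -1), (-1, -1, 0), (0, -1, -1), (-1, 0, -1)]"], of "laurent 1 1 1"]
      by (simp add: stencils_def laurent_0 laurent_mult distrib_left ac_simps)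
    show "1 + laurent 1 0 0 * laurent 0 1 0 + laurent 0 1 0 * laurent 0 0 1
        + laurent 0 0 1 * laurent 1 0 0 \<in> relations ZGen"
      using relations_mult [OF disjI2 [OF refl] relations_stencil
          [of ZGen "[(-1, -1, -1), (-1, 0, 0), (0, -1, 0), (0, 0, -1)]"], of "laurent 1 1 1"]
      by (simp add: stencils_def laurent_0 laurent_mult distrib_left ac_simps)
    show "laurent 0 0 1 ^ (2 ^ i * l) - 1 \<in> relations ZGen"
      using period [of "int L"] assms by (simp add: laurent_power)
  qed (simp_all add: relations_0 relations_add relations_mult two_laurent assms(2))
qed

text \<open>Laurent monomials are units; this removes the surplus powers of \<open>x\<close> and
  \<open>x y\<close> left by the computations in \<open>cubic_ideal\<close>.\<close>

lemma relations_cancel: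
  assumes "G = XGen \<or> G = ZGen" "laurent a b c * p \<in> relations G"
  shows "p \<in> relations G"
proof -
  have "laurent (- a) (- b) (- c) * (laurent a b c * p) = p"
    by (simp add: mult.assoc [symmetric] laurent_mult laurent_0)
  then show ?thesis using relations_mult [OF assms, of "laurent (- a) (- b) (- c)"] by simp
qed

lemma acts_trivially_x:
  assumes "L = 2 ^ i * l" "odd l" "even k" "[2 ^ k = 1] (mod l)"
  shows "acts_trivially (multiple (2 ^ (i + 1) * (2 ^ k - 1)) (1, 0, 0))"
proof -
  define m where "m = 2 ^ (i + 1) * (2 ^ k - 1 :: nat)"
  define n where "n = (2 ^ (i + 1) :: nat)"
  have nm: "2 ^ (i + 1 + k) = n + m"
    unfolding n_def m_def by (simp add: power_add algebra_simps)
  have "laurent (- int (n + m)) 0 0 - laurent (- int n) 0 0 \<in> relations XGen"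
    using cubic_ideal.x_frobenius_period [OF cubic_ideal_relations(1) [OF assms(1,2)] assms(3,4)]
    unfolding cubic_ideal.eqv_def [OF cubic_ideal_relations(1) [OF assms(1,2)]] nm
    by (simp add: laurent_power n_def)
  \<comment> \<open>For \<open>XGen\<close> the role of \<open>x\<close> is played by the inverse
    monomial, so the term of lower exponent is factored out.\<close>
  also have "laurent (- int (n + m)) 0 0 - laurent (- int n) 0 0
      = laurent (- int (n + m)) 0 0 * (laurent (int m) 0 0 - 1)"
    by (simp add: diff_laurent distrib_left laurent_mult add.commute)
  finally have X: "laurent (int m) 0 0 - 1 \<in> relations XGen"
    by (rule relations_cancel [rotated]) simp
  have "laurent (int (n + m)) 0 0 - laurent (int n) 0 0 \<in> relations ZGen"
    using cubic_ideal.x_frobenius_period [OF cubic_ideal_relations(2) [OF assms(1,2)] assms(3,4)]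
    unfolding cubic_ideal.eqv_def [OF cubic_ideal_relations(2) [OF assms(1,2)]] nm
    by (simp add: laurent_power n_def)
  also have "laurent (int (n + m)) 0 0 - laurent (int n) 0 0 = laurent (int n) 0 0 * (laurent (int m) 0 0 - 1)"
    by (simp add: right_diff_distrib laurent_mult)
  finally have Z: "laurent (int m) 0 0 - 1 \<in> relations ZGen"
    by (rule relations_cancel [rotated]) simp
  show ?thesis
    using acts_trivially_if_relations [OF X Z] by (simp add: m_def)
qed

lemma acts_trivially_z:
  assumes "L = 2 ^ i * l" "l = 3"
  shows "acts_trivially (multiple (2 ^ i) (0, 0, 1))"
proof -
  have odd: "odd l" using assms(2) by simp
  define n where "n = (2 ^ i :: nat)"
  have "laurent (- int n) (- int n) (- int n) - laurent (- int n) (- int n) 0 \<in> relations XGen"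
    using cubic_ideal.z_power_if_l_eq_3 [OF cubic_ideal_relations(1) [OF assms(1) odd] assms(2)]
    unfolding cubic_ideal.eqv_def [OF cubic_ideal_relations(1) [OF assms(1) odd]]
    by (simp add: laurent_power laurent_mult n_def)
  also have "laurent (- int n) (- int n) (- int n) - laurent (- int n) (- int n) 0
      = laurent (- int n) (- int n) (- int n) * (laurent 0 0 (int n) - 1)"
    by (simp add: diff_laurent distrib_left laurent_mult add.commute)
  finally have X: "laurent 0 0 (int n) - 1 \<in> relations XGen"
    by (rule relations_cancel [rotated]) simp
  have "laurent (int n) (int n) (int n) - laurent (int n) (int n) 0 \<in> relations ZGen"
    using cubic_ideal.z_power_if_l_eq_3 [OF cubic_ideal_relations(2) [OF assms(1) odd] assms(2)]
    unfolding cubic_ideal.eqv_def [OF cubic_ideal_relations(2) [OF assms(1) odd]]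
    by (simp add: laurent_power laurent_mult n_def)
  also have "laurent (int n) (int n) (int n) - laurent (int n) (int n) 0
      = laurent (int n) (int n) 0 * (laurent 0 0 (int n) - 1)"
    by (simp add: right_diff_distrib laurent_mult)
  finally have Z: "laurent 0 0 (int n) - 1 \<in> relations ZGen"
    by (rule relations_cancel [rotated]) simp
  show ?thesis
    using acts_trivially_if_relations [OF X Z] by (simp add: n_def)
qed

lemma acts_trivially_period: "acts_trivially (multiple L (0, 0, 1))"
proof -
  have "translate L (0, 0, int L) v = v" if "v \<in> sites L" for v
    using that by (auto simp: translate_eq sites_def)
  then show ?thesis
    by (auto simp: acts_trivially_def generators_def empty_created)
qed

end

section \<open>Detecting nontrivial excitations\<close>

text \<open>Lower bounds on the orders require an invariant of anyon types: an additive map from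
  excitations to a ring that sends every created set into \<open>I\<close>.\<close>

locale cubic_charge = cubic_code L + cubic_ideal I x y z i l
  for L I and x y z :: "'a::comm_ring_1" and i l +
  fixes k m :: nat
  assumes L_eq: "L = 2 ^ i * l"
    and k: "even k" "0 < k" "[2 ^ k = 1] (mod l)"
    and m: "m = 2 ^ (i + 1) * (2 ^ k - 1)"
begin

abbreviation mon :: "site \<Rightarrow> 'a" where "mon \<equiv> monomial m"

lemmas mon_add_x = monomial_add_x [OF k m]
  and mon_add_y = monomial_add_y [OF k m]
  and mon_add_z = monomial_add_z [OF k m]

lemma mon_translate: "mon (translate L d w) = mon (w + d)"
  using monomial_mod [OF k m] by (cases d; cases w) (simp add: translate_def L_eq)

text \<open>Detecting nontriviality on one type of generator is enough; for \<open>ZGen\<close> the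
  translations act by \<open>x\<close>, \<open>y\<close>, \<open>z\<close> themselves rather than by
  their inverses.\<close>

definition charge :: "generator set \<Rightarrow> 'a" where
  "charge S = sum mon (ZGen -` S)"

lemma finite_vimage_ZGen: "finite S \<Longrightarrow> finite (ZGen -` S)"
  by (rule finite_vimageI) (auto simp: inj_def)

lemma charge_sym_diff:
  assumes "finite S" "finite T"
  shows "charge (sym_diff S T) = charge S + charge T"
proof -
  define A B where "A = ZGen -` S" and "B = ZGen -` T"
  have fin: "finite A" "finite B" using assms by (simp_all add: A_def B_def finite_vimage_ZGen)
  have "sum mon (sym_diff A B) = sum mon (A - B) + sum mon (B - A)"
    using fin by (intro sum.union_disjoint) auto
  also have "\<dots> = (sum mon (A - B) + sum mon (A \<inter> B)) + (sum mon (B - A) + sum mon (B \<inter> A))"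
    using double [of "sum mon (A \<inter> B)"] by (simp add: Int_commute algebra_simps)
  also have "\<dots> = sum mon A + sum mon B"
    using fin sum.Int_Diff [of A mon B] sum.Int_Diff [of B mon A] by (simp add: add.commute)
  finally show ?thesis
    by (simp add: charge_def A_def B_def vimage_Diff)
qed

lemma charge_empty: "charge {} = 0"
  by (simp add: charge_def)

lemma charge_ZGen: "charge {ZGen v} = mon v"
proof -
  have "ZGen -` {ZGen v} = {v}" by auto
  then show ?thesis by (simp add: charge_def)
qed

lemma charge_cluster: "charge (cluster ZGen ds w) = (\<Sum>d\<leftarrow>ds. mon (w + d))"
  by (induction ds) (simp_all add: charge_empty charge_sym_diff charge_ZGen mon_translate)

lemma charge_cluster_XGen: "charge (cluster XGen ds w) = 0"
proof (induction ds)
  case (Cons d ds)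
  have "ZGen -` {XGen v} = {}" for v by auto
  then have "charge {XGen v} = 0" for v by (simp add: charge_def)
  with Cons show ?case by (simp add: charge_sym_diff)
qed (simp add: charge_empty)

lemma charge_created: "S \<in> created L \<Longrightarrow> charge S \<in> I"
proof (induction rule: created_induct)
  case (sym_diff S T)
  then show ?case using created_subset by (simp add: charge_sym_diff add_in)
next
  case (cluster G ds w)
  \<comment> \<open>The displacements in a stencil are 0 or -1, so relative to the corner
    \<open>(a, b, c)\<close> all exponents are nonnegative and the charge becomes a multiple of
    \<open>e\<close>.\<close>
  obtain a b c where w: "w = (a + 1, b + 1, c + 1)"
    by (metis diff_add_cancel prod_cases3)
  define e where "e = mon (a, b, c)"
  have ex: "eqv (mon (a + 1, b, c)) (x * e)" and ey: "eqv (mon (a, b + 1, c)) (y * e)"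
    and ez: "eqv (mon (a, b, c + 1)) (z * e)"
    unfolding e_def by (rule mon_add_x mon_add_y mon_add_z)+
  have exy: "eqv (mon (a + 1, b + 1, c)) (x * (y * e))"
    by (rule eqv_trans [OF mon_add_x eqv_mult [OF eqv_refl ey]])
  have eyz: "eqv (mon (a, b + 1, c + 1)) (y * (z * e))"
    by (rule eqv_trans [OF mon_add_y eqv_mult [OF eqv_refl ez]])
  have ezx: "eqv (mon (a + 1, b, c + 1)) (z * (x * e))"
    by (rule eqv_trans [OF mon_add_z eqv_mult [OF eqv_refl ex]])
  have "eqv (e + (mon (a, b, c + 1) + (mon (a + 1, b, c) + mon (a, b + 1, c))))
      (e + (z * e + (x * e + y * e)))"
    by (intro eqv_add ex ey ez eqv_refl)
  also have "e + (z * e + (x * e + y * e)) = e * (1 + x + y + z)"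
    by (simp add: algebra_simps)
  also have "eqv \<dots> 0"
    unfolding eqv_0_iff by (intro mult_in linear_in)
  finally have 1: "e + (mon (a, b, c + 1) + (mon (a + 1, b, c) + mon (a, b + 1, c))) \<in> I"
    by (simp add: eqv_0_iff)
  have "eqv (e + (mon (a, b + 1, c + 1) + (mon (a + 1, b, c + 1) + mon (a + 1, b + 1, c))))
      (e + (y * (z * e) + (z * (x * e) + x * (y * e))))"
    by (intro eqv_add exy eyz ezx eqv_refl)
  also have "e + (y * (z * e) + (z * (x * e) + x * (y * e))) = e * (1 + x * y + y * z + z * x)"
    by (simp add: algebra_simps)
  also have "eqv \<dots> 0"
    unfolding eqv_0_iff by (intro mult_in quadratic_in)
  finally have 2: "e + (mon (a, b + 1, c + 1) + (mon (a + 1, b, c + 1) + mon (a + 1, b + 1, c))) \<in> I"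
    by (simp add: eqv_0_iff)
  have "charge (cluster G ds w) = 0 \<or>
      charge (cluster G ds w) = e + (mon (a, b, c + 1) + (mon (a + 1, b, c) + mon (a, b + 1, c))) \<or>
      charge (cluster G ds w)
        = e + (mon (a, b + 1, c + 1) + (mon (a + 1, b, c + 1) + mon (a + 1, b + 1, c)))"
    using cluster(1) unfolding stencils_def
    by (auto simp: charge_cluster charge_cluster_XGen w e_def simp del: cluster_simps)
  with 1 2 show ?case by (auto simp: zero_in)
qed (simp add: charge_empty zero_in)

lemma acts_trivially_imp_eqv:
  assumes "acts_trivially d"
  shows "eqv (mon d) (mon (0, 0, 0))"
proof -
  have "ZGen (0, 0, 0) \<in> generators L" using L_pos by (simp add: sites_def)
  then have "sym_diff {translate_generator L d (ZGen (0, 0, 0))} {ZGen (0, 0, 0)} \<in> created L"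
    using assms unfolding acts_trivially_def by blast
  then have "charge (sym_diff {ZGen (translate L d (0, 0, 0))} {ZGen (0, 0, 0)}) \<in> I"
    unfolding translate_generator.simps by (rule charge_created)
  then have "mon (translate L d (0, 0, 0)) + mon (0, 0, 0) \<in> I"
    by (simp add: charge_sym_diff charge_ZGen)
  then show ?thesis
    by (cases d) (simp add: mon_translate eqv_def diff_eq)
qed

text \<open>The charge at the origin is \<open>(x * y) ^ m\<close>, equivalent to
  \<open>u ^ m\<close> rather than 1; \<open>u_torsion\<close> replaces the exponent
  \<open>m\<close> by \<open>2 ^ i\<close>.\<close>

lemma torsion_if_eqv:
  assumes "eqv (a * mon (0, 0, 0)) (mon (0, 0, 0))"
  shows "u ^ 2 ^ i * (a - 1) \<in> I"
proof (rule u_torsion)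
  have "eqv ((x * y) ^ m * (a - 1)) 0"
    using assms by (simp add: eqv_def monomial_0 [OF k m] algebra_simps)
  moreover have "eqv (u ^ m * (a - 1)) ((x * y) ^ m * (a - 1))"
    by (intro eqv_mult eqv_power eqv_sym [OF xy_eqv_u] eqv_refl)
  ultimately have "eqv (u ^ m * (a - 1)) 0" by (rule eqv_trans [rotated])
  then show "u ^ m * (a - 1) \<in> I" by (simp add: eqv_0_iff)
qed

lemma acts_trivially_x_imp:
  assumes "acts_trivially (multiple n (1, 0, 0))"
  shows "u ^ 2 ^ i * (x ^ n - 1) \<in> I"
proof -
  have "eqv (mon (int n, 0, 0)) (x ^ n * mon (0, 0, 0))" for n
  proof (induction n)
    case (Suc n)
    have "eqv (mon (int n + 1, 0, 0)) (x * (x ^ n * mon (0, 0, 0)))"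
      by (rule eqv_trans [OF mon_add_x eqv_mult [OF eqv_refl Suc]])
    then show ?case by (simp add: mult.assoc add.commute)
  qed simp
  moreover have "eqv (mon (int n, 0, 0)) (mon (0, 0, 0))"
    using acts_trivially_imp_eqv [OF assms] by simp
  ultimately show ?thesis
    by (meson torsion_if_eqv eqv_sym eqv_trans)
qed

lemma acts_trivially_z_imp:
  assumes "acts_trivially (multiple n (0, 0, 1))"
  shows "u ^ 2 ^ i * (z ^ n - 1) \<in> I"
proof -
  have "eqv (mon (0, 0, int n)) (z ^ n * mon (0, 0, 0))" for n
  proof (induction n)
    case (Suc n)
    have "eqv (mon (0, 0, int n + 1)) (z * (z ^ n * mon (0, 0, 0)))"
      by (rule eqv_trans [OF mon_add_z eqv_mult [OF eqv_refl Suc]])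
    then show ?case by (simp add: mult.assoc add.commute)
  qed simp
  moreover have "eqv (mon (0, 0, int n)) (mon (0, 0, 0))"
    using acts_trivially_imp_eqv [OF assms] by simp
  ultimately show ?thesis
    by (meson torsion_if_eqv eqv_sym eqv_trans)
qed

end

section \<open>Evaluation of the translation orders\<close>

context cubic_code
begin

lemma acts_trivially_imp_dvd:
  assumes "L = 2 ^ i * l" "odd l" "even k" "0 < k" "[2 ^ k = 1] (mod l)"
  shows "acts_trivially (multiple n (1, 0, 0)) \<Longrightarrow>
      const ((1 + Z) ^ (2 ^ i * l) - 1) dvd const V ^ 2 ^ i * (qx ^ n - 1)"
    and "acts_trivially (multiple n (0, 0, 1)) \<Longrightarrow>
      (1 + Z) ^ (2 ^ i * l) - 1 dvd V ^ 2 ^ i * ((1 + Z) ^ n - 1)"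
proof -
  define P where "P = (1 + Z) ^ (2 ^ i * l) - 1"
  have "const P = qz ^ (2 ^ i * l) - 1"
    by (simp add: P_def qz_power one_quad_def const_diff)
  then interpret ideal: cubic_ideal "{p. const P dvd p}" qx qy qz i l
    by (intro cubic_ideal_quad assms) simp
  interpret cubic_charge L "{p. const P dvd p}" qx qy qz i l k "2 ^ (i + 1) * (2 ^ k - 1)"
    by unfold_locales (use assms in auto)
  show "const ((1 + Z) ^ (2 ^ i * l) - 1) dvd const V ^ 2 ^ i * (qx ^ n - 1)"
    if "acts_trivially (multiple n (1, 0, 0))"
    using acts_trivially_x_imp [OF that] by (simp add: ideal.u_def u_quad P_def)
  show "(1 + Z) ^ (2 ^ i * l) - 1 dvd V ^ 2 ^ i * ((1 + Z) ^ n - 1)"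
    if "acts_trivially (multiple n (0, 0, 1))"
  proof -
    have "const P dvd const V ^ 2 ^ i * (qz ^ n - 1)"
      using acts_trivially_z_imp [OF that] by (simp add: ideal.u_def u_quad)
    also have "qz ^ n - 1 = const ((1 + Z) ^ n - 1)"
      by (simp add: qz_power one_quad_def const_diff)
    finally have "const P dvd const (V ^ 2 ^ i * ((1 + Z) ^ n - 1))"
      by (simp only: const_power const_mult quad.sel mult_zero_right)
    then show ?thesis by (simp only: const_dvd_iff quad.sel P_def)
  qed
qed

lemma order_x_dvd:
  assumes "L = 2 ^ i * l" "odd l" "even k" "0 < k" "[2 ^ k = 1] (mod l)"
  shows "order_x L dvd 2 ^ (i + 1) * (2 ^ k - 1)"
    and "0 < order_x L" "acts_trivially (multiple (order_x L) (1, 0, 0))"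
    and "order_x L \<le> 2 ^ (i + 1) * (2 ^ k - 1)"
proof -
  have "(1::nat) < 2 ^ k" using assms(4) by (intro one_less_power) simp_all
  then have pos: "0 < (2::nat) ^ (i + 1) * (2 ^ k - 1)" by simp
  note trivial = acts_trivially_x [OF assms(1-3,5)]
  show dvd: "order_x L dvd 2 ^ (i + 1) * (2 ^ k - 1)"
    by (rule translation_order_dvd [OF pos trivial])
  show "order_x L \<le> 2 ^ (i + 1) * (2 ^ k - 1)"
    by (rule dvd_imp_le [OF dvd pos])
  show "0 < order_x L" "acts_trivially (multiple (order_x L) (1, 0, 0))"
    by (rule translation_order_trivial [OF pos trivial])+
qed

text \<open>With \<open>k = n\<close> the order divides \<open>2 L\<close>. A smaller order would
  either divide \<open>L\<close>, which is refuted modulo \<open>Z ^ 2 ^ i\<close>, or be at most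
  \<open>2 L / 3\<close>, which is refuted by degrees.\<close>

lemma order_x_eq:
  assumes "L = 2 ^ i * l" "odd l" "even n" "l = 2 ^ n - 1" "l \<noteq> 3"
  shows "order_x L = 2 ^ (i + 1) * l"
proof (rule ccontr)
  define r where "r = order_x L"
  assume "order_x L \<noteq> 2 ^ (i + 1) * l"
  then have neq: "r \<noteq> 2 * L" by (simp add: r_def assms(1))
  have n: "0 < n" using assms by (intro Nat.gr0I) auto
  have "n \<noteq> 2" using assms(4,5) by auto
  with n assms(3) have "3 \<le> n"
    by (metis One_nat_def Suc_leI dvd_1_iff_1 even_Suc le_neq_implies_less numeral_2_eq_2
        numeral_3_eq_3 odd_one)
  then have "(2::nat) ^ 3 \<le> 2 ^ n" by (intro power_increasing) auto
  then have l7: "7 \<le> l" using assms(4) by simp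
  have cong: "[2 ^ n = 1] (mod l)"
    by (simp add: cong_altdef_nat assms(4))
  note * = assms(1-3) n cong
  have r: "r dvd 2 * L" "0 < r" "acts_trivially (multiple r (1, 0, 0))"
    using order_x_dvd(1-3) [OF *] unfolding assms(1,4) [symmetric] r_def
    by (simp_all add: assms(1) mult.assoc)
  note nontrivial = acts_trivially_imp_dvd(1) [OF *]
  have "\<not> r dvd L"
  proof
    assume "r dvd L"
    then have "acts_trivially (multiple (2 ^ i * l) (1, 0, 0))"
      using r(3) acts_trivially_dvd assms(1) by blast
    then show False
      using nontrivial qx_power_nontrivial_period [OF assms(2)] by blast
  qed
  obtain q where q: "2 * L = r * q" using r(1) by blast
  have "q \<noteq> 0" using q L_pos by (intro notI) simp
  moreover have "q \<noteq> 1" using q neq by auto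
  moreover have "q \<noteq> 2" using q \<open>\<not> r dvd L\<close> by auto
  ultimately have "3 \<le> q" by linarith
  then have "3 * r \<le> 2 * L" using q by (metis mult.commute mult_le_mono2)
  then show False
    using nontrivial [OF r(3)] qx_power_nontrivial_below [OF r(2) _ l7] assms(1) by blast
qed

lemma order_z_eq:
  assumes "L = 2 ^ i * l" "odd l"
  shows "order_z L = (if l = 3 then 2 ^ i else L)"
proof -
  define r where "r = order_z L"
  have r: "0 < r" "acts_trivially (multiple r (0, 0, 1))" "r dvd L"
    using translation_order_trivial [OF L_pos acts_trivially_period]
      translation_order_dvd [OF L_pos acts_trivially_period] by (simp_all add: r_def)
  define k where "k = 2 * ord l 2"
  have "0 < ord l 2" using assms(2) by simp
  moreover have "[2 ^ k = 1] (mod l)"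
    unfolding k_def ord_divides by simp
  ultimately have k: "even k" "0 < k" "[2 ^ k = 1] (mod l)" by (simp_all add: k_def)
  have dvd: "(1 + Z) ^ (2 ^ i * l) - 1 dvd V ^ 2 ^ i * ((1 + Z) ^ r - 1)"
    by (rule acts_trivially_imp_dvd(2) [OF assms k r(2)])
  then have ge: "2 ^ i \<le> r"
    using qz_power_nontrivial_below [OF r(1)] by (metis not_le)
  \<comment> \<open>For \<open>l = 1\<close> the lower bound \<open>2 ^ i\<close> equals
    \<open>L\<close>, for \<open>l = 3\<close> it meets the period \<open>2 ^ i\<close>, and for
    larger \<open>l\<close> a proper divisor of \<open>L\<close> is excluded by degrees.\<close>
  consider "l = 1" | "l = 3" | "5 \<le> l"
    using assms(2) by (cases "l = 1 \<or> l = 3") (auto elim!: oddE)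
  then have "r = (if l = 3 then 2 ^ i else L)"
  proof cases
    case 1
    with ge r(3) L_pos show ?thesis by (auto simp: assms(1) dest: dvd_imp_le)
  next
    case 2
    have "r dvd 2 ^ i"
      unfolding r_def by (rule translation_order_dvd [OF _ acts_trivially_z [OF assms(1) 2]]) simp
    with ge 2 show ?thesis by (auto dest: dvd_imp_le)
  next
    case 3
    obtain q where q: "L = r * q" using r(3) by blast
    have "q = 1"
    proof (rule ccontr)
      assume "q \<noteq> 1"
      moreover have "q \<noteq> 0" using q L_pos by auto
      ultimately have "2 \<le> q" by linarith
      then have "2 * r \<le> L" using q by (metis mult.commute mult_le_mono2)
      then show False
        using dvd qz_power_nontrivial_half [OF r(1) _ 3] assms(1) by blast
    qed
    then show ?thesis using 3 q by simp
  qed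
  then show ?thesis by (simp add: r_def)
qed

end

theorem proposition1:
  fixes L i l k :: nat
  assumes "L = 2 ^ i * l" and "odd l"
    and "k = lcm 2 (ord l 2)"
  shows "order_x L = order_y L \<and>
         order_x L \<le> 2 ^ (i + 1) * (2 ^ k - 1) \<and>
         (l \<noteq> 1 \<longrightarrow> order_x L \<le> 2 ^ (i + 1) * (2 ^ (l - 1) - 1)) \<and>
         (\<forall>n. even n \<and> l = 2 ^ n - 1 \<and> l \<noteq> 3 \<longrightarrow> order_x L = 2 ^ (i + 1) * l) \<and>
         (\<forall>n. odd n \<and> l = 2 ^ n - 1 \<longrightarrow> order_x L \<le> 2 ^ (i + 1) * l * (l + 2)) \<and>
         (l \<noteq> 3 \<longrightarrow> order_z L = L) \<and>
         (l = 3 \<longrightarrow> order_z L = 2 ^ i)"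
proof -
  have "0 < l" using assms(2) by (rule odd_pos)
  then interpret cubic_code L by unfold_locales (simp add: assms(1))
  have "coprime l 2" using assms(2) by simp
  have "0 < ord l 2" using assms(2) by simp
  then have k: "even k" "0 < k" "ord l 2 dvd k"
    using assms(3) by (simp_all add: lcm_pos_nat)
  then have bound: "order_x L \<le> 2 ^ (i + 1) * (2 ^ k - 1)"
    using order_x_dvd(4) [OF assms(1,2)] ord_divides by blast
  have "order_x L \<le> 2 ^ (i + 1) * (2 ^ (l - 1) - 1)" if "l \<noteq> 1"
  proof -
    have "3 \<le> l" using that assms(2) \<open>0 < l\<close> by (auto elim!: oddE)
    \<comment> \<open>Both 2 and the order of 2 divide the totient, hence so does their least common
      multiple \<open>k\<close>.\<close>
    then have "even (totient l)" by (intro totient_even) simp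
    moreover have "ord l 2 dvd totient l"
      by (rule order_divides_totient) fact
    ultimately have "k dvd totient l" by (simp add: assms(3))
    then have "k \<le> totient l" using \<open>0 < l\<close> by (intro dvd_imp_le) simp_all
    also have "totient l \<le> l - 1"
      using totient_less [of l] \<open>3 \<le> l\<close> by simp
    finally have "(2::nat) ^ k \<le> 2 ^ (l - 1)" by (intro power_increasing) auto
    then have "2 ^ (i + 1) * (2 ^ k - 1) \<le> (2::nat) ^ (i + 1) * (2 ^ (l - 1) - 1)"
      by (intro mult_le_mono diff_le_mono) auto
    with bound show ?thesis by (rule le_trans)
  qed
  moreover have "order_x L \<le> 2 ^ (i + 1) * l * (l + 2)" if "odd n" "l = 2 ^ n - 1" for n
  proof -
    \<comment> \<open>As \<open>n\<close> is odd, the even exponent \<open>2 * n\<close> serves as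
      period, and \<open>2 ^ (2 * n) - 1\<close> factors as
      \<open>(2 ^ n - 1) * (2 ^ n + 1)\<close>.\<close>
    have "[2 ^ n = 1] (mod l)" by (simp add: cong_altdef_nat that(2))
    then have "[(2 ^ n)\<^sup>2 = 1\<^sup>2] (mod l)" by (rule cong_pow)
    then have "[2 ^ (2 * n) = 1] (mod l)" by (simp add: mult.commute flip: power_mult)
    moreover have "0 < n" using that(1) by (rule odd_pos)
    ultimately have "order_x L \<le> 2 ^ (i + 1) * (2 ^ (2 * n) - 1)"
      by (intro order_x_dvd(4) [OF assms(1,2)]) auto
    moreover have "(2::nat) ^ n = l + 1" using that(2) by simp
    then have "(2::nat) ^ (2 * n) - 1 = l * (l + 2)"
      by (simp add: power_mult mult.commute [of 2] power2_eq_square)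
    ultimately show ?thesis by (simp only: mult.assoc)
  qed
  ultimately show ?thesis
    using bound order_x_eq [OF assms(1,2)] order_z_eq [OF assms(1,2)] order_x_eq_order_y by auto
qed

end
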